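(* Let $\mathcal{T}=(\mathbb{T},V,\xi)$ be a strict topological theory with $T1=1$. The functor $V^{-}\colon(\mathcal{T}\text{-}\mathrm{Cat})^{\mathrm{op}}\to V\text{-}\mathrm{Cont}$, sending a $\mathcal{T}$-category $X$ to the $V$-category $V^X$ of $\mathcal{T}$-functors $X\to V$ and a $\mathcal{T}$-functor $f\colon X\to Y$ to $V^f\colon V^Y\to V^X$, $\varphi\mapsto\varphi\cdot f$, factors through the forgetful functor $\mathcal{T}\text{-}\mathrm{Frm}\to V\text{-}\mathrm{Cont}$, via a functor $\Omega\colon(\mathcal{T}\text{-}\mathrm{Cat})^{\mathrm{op}}\to\mathcal{T}\text{-}\mathrm{Frm}$ where $\Omega(X)$ is the $\mathcal{T}$-graph $V^X$ and $\Omega(f)=V^f$.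
   Context: **Quantales and theories.** $V=(V,\bigvee,\otimes,k)$ is a commutative quantale: a complete lattice with a commutative associative operation $\otimes$ with unit $k$, preserving suprema in each variable; $\hom$ is defined by $x\otimes y\le z\iff x\le\hom(y,z)$. A strict topological theory $\mathcal{T}=(\mathbb{T},V,\xi)$ consists of a monad $\mathbb{T}=(T,m,e)$ on $\mathrm{Set}$, a commutative quantale $V$ and a map $\xi\colon TV\to V$ such that: (a) $T$ sends pullbacks to weak pullbacks and every naturality square of $m$ is a weak pullback; (b) $(V,\xi)$ is an Eilenberg–Moore $\mathbb{T}$-algebra, and $\otimes\colon V\times V\to V$ and $k\colon 1\to V$ are $\mathbb{T}$-homomorphisms, i.e. $\xi(T(\otimes)(w))=\xi(T\pi_1(w))\otimes\xi(T\pi_2(w))$ for $w\in T(V\times V)$ and $\xi(T(k)(t))=k$ for $t\in T1$; (c) the maps $\xi_X\colon V^X\to V^{TX}$, $\varphi\mapsto\xi\cdot T\varphi$ (on sets of functions, pointwise order) are monotone and natural: for $f\colon X\to Y$ and $\varphi\colon X\to V$, with $(P_Vf)(\varphi)(y)=\bigvee_{f(x)=y}\varphi(x)$, one has $\xi_Y(P_Vf(\varphi))=P_V(Tf)(\xi_X(\varphi))$. Here $T1=1$ means that $T$ of a one-element set is a one-element set. **Matrices.** A $V$-matrix $r\colon X\to Y$ is a map $r\colon Y\times X\to V$. Put $T_\xi r(\mathfrak{y},\mathfrak{x})=\bigvee\{\xi(Tr(w))\mid w\in T(Y\times X),T\pi_1(w)=\mathfrak{y},T\pi_2(w)=\mathfrak{x}\}$.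 **$\mathcal{T}$-graphs, categories, functors.** A $\mathcal{T}$-graph $(X,a)$ is a set with $a\colon TX\times X\to V$ such that $k\le a(e_X(x),x)$ for all $x$; it is a $\mathcal{T}$-category if also $T_\xi a(\mathfrak{X},\mathfrak{y})\otimes a(\mathfrak{y},x)\le a(m_X(\mathfrak{X}),x)$ for all $\mathfrak{X}\in TTX$, $\mathfrak{y}\in TX$, $x\in X$. A $\mathcal{T}$-graph morphism ($\mathcal{T}$-functor, between $\mathcal{T}$-categories) $f\colon(X,a)\to(Y,b)$ is a map with $a(\mathfrak{x},x)\le b(Tf(\mathfrak{x}),f(x))$. The underlying $V$-graph of $(X,a)$ is $X$ with $X(x',x)=a(e_X(x'),x)$. A $\mathbb{T}$-algebra $(I,\alpha)$ is viewed as a $\mathcal{T}$-category with structure $(\mathfrak{i},i)\mapsto k$ if $\alpha(\mathfrak{i})=i$, $\bot$ otherwise. $V$ is a $\mathcal{T}$-category with structure $(\mathfrak{v},v)\mapsto\hom(\xi(\mathfrak{v}),v)$. **$V$-categorical notions.** For $V$-categories (hom-objects $A(x,y)\in V$), a $V$-distributor $1\to A$ is a map $\varphi\colon A\to V$ with $A(x,y)\otimes\varphi(y)\le\varphi(x)$; $PA$ is the $V$-category of these with $PA(\varphi,\varphi')=\bigwedge_x\hom(\varphi(x),\varphi'(x))$. A $V$-distributor $I\to1$ is a map $\varphi\colon I\to V$ with $\varphi(i)\otimes I(i,j)\le\varphi(j)$. $\sup_A\varphi$ is an object with $A(\sup_A\varphi,y)=\bigwedge_x\hom(\varphi(x),A(x,y))$.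 For $\psi\colon1\to I$ and a $V$-functor $h\colon I\to A$, the colimit $c$ satisfies $A(c,y)=\bigwedge_i\hom(\psi(i),A(h(i),y))$; for $\varphi\colon I\to1$, $\lim(\varphi,h)$ satisfies $A(y,\lim(\varphi,h))=\bigwedge_i\hom(\varphi(i),A(y,h(i)))$. The tensor $v\otimes x$ satisfies $A(v\otimes x,y)=\hom(v,A(x,y))$. Such objects are unique up to isomorphism, and equalities between them are meant up to isomorphism. Complete means having all weighted limits (hence all weighted colimits). $V\text{-}\mathrm{Cont}$ is the category of complete $V$-categories and weighted-limit-preserving $V$-functors. **$\mathcal{T}$-frames.** Let $A$ be a $\mathcal{T}$-graph whose underlying $V$-graph is a $V$-category with tensors (also denoted $A$). A $\mathcal{T}$-weighted diagram in $A$ is a set $I$ with a $\mathbb{T}$-algebra structure and a $V$-category structure, a $V$-functor $h\colon I\to A$ and a $V$-distributor $\psi\colon 1\to I$ such that $i\mapsto\psi(i)\otimes h(i)$ (for some choice of tensors) is a $\mathcal{T}$-graph morphism $I\to A$; its colimit is a $\mathcal{T}$-weighted colimit. A $V$-distributor $\varphi\colon1\to A$ is $\mathcal{T}$-generated if $\varphi(x)=\bigvee_iA(x,h(i))\otimes\psi(i)$ for such $h,\psi$. A $\mathcal{T}$-frame is a $\mathcal{T}$-graph $A$ whose underlying $V$-graph is a complete $V$-category such that for any $V$-category $I$, $V$-distributor $\varphi\colon I\to1$ and $V$-functor $h\colon I\to PA$ with all $h(i)$ $\mathcal{T}$-generated: if $\lim(\varphi,h)$ is $\mathcal{T}$-generated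 then $\sup_A(\lim(\varphi,h))=\lim(\varphi,\sup_A\cdot h)$. A $V$-functor $f\colon A\to B$ is $\mathcal{T}$-compatible if for each $\mathbb{T}$-algebra $I$ and $\mathcal{T}$-graph morphism $h\colon I\to A$, $f\cdot h$ is a $\mathcal{T}$-graph morphism. A $\mathcal{T}$-frame homomorphism is a $\mathcal{T}$-compatible $V$-functor between the underlying $V$-categories preserving weighted limits and $\mathcal{T}$-weighted colimits. These form the category $\mathcal{T}\text{-}\mathrm{Frm}$; the forgetful functor to $V\text{-}\mathrm{Cont}$ takes underlying $V$-categories. **$V^X$.** For a $\mathcal{T}$-category $X=(X,a)$, $V^X$ is the set of $\mathcal{T}$-functors $X\to V$; as a $V$-category it has $[\varphi',\varphi]=\bigwedge_x\hom(\varphi'(x),\varphi(x))$, and it is complete, with limits computed pointwise. It is the underlying $V$-category of the $\mathcal{T}$-graph $V^X$ with structure $(\mathfrak{p},\varphi)\mapsto\bigwedge\{\hom(a(T\pi_1(\mathfrak{q}),x),\hom(\xi(T\mathrm{ev}(\mathfrak{q})),\varphi(x)))\mid x\in X,\mathfrak{q}\in T(X\times V^X),T\pi_2(\mathfrak{q})=\mathfrak{p}\}$, $\mathrm{ev}\colon X\times V^X\to V$ being evaluation. *)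

theory Defs
  imports Complex_Main "HOL-Library.FuncSet"
begin

section \<open>The universe of sets\<close>

text \<open>A functor on the category Set acts on all sets, including sets of functions and sets of
  values of other functors, so it cannot be a function on HOL types. Sets are therefore taken from a
  universe: a type whose elements code its small subsets, closed under subsets, unions, power sets
  and replacement. These are the axioms of Paulson's ZFC in HOL without infinity and foundation,
  which are not required; a model of (second-order) ZFC and a Grothendieck universe are instances.
  The objects of Set are the small HOL sets, the maps are HOL functions considered on their
  domain.\<close>

class set_universe =
  fixes elts :: "'a \<Rightarrow> 'a set"
  assumes elts_inject: "elts x = elts y \<Longrightarrow> x = y"
    and elts_subset: "B \<subseteq> elts x \<Longrightarrow> B \<in> range elts"
    and elts_Union: "\<Union> (elts ` elts x) \<in> range elts"
    and elts_Pow: "{y. elts y \<subseteq> elts x} \<in> range elts"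
    and elts_replacement: "f ` elts x \<in> range elts"

definition small :: "'u::set_universe set \<Rightarrow> bool" where
  "small A \<longleftrightarrow> A \<in> range elts"

definition set_code :: "'u::set_universe set \<Rightarrow> 'u" where
  "set_code A = inv elts A"

definition pair :: "'u::set_universe \<Rightarrow> 'u \<Rightarrow> 'u" where
  "pair x y = set_code {set_code {x}, set_code {x, y}}"

definition pfst :: "'u::set_universe \<Rightarrow> 'u" where
  "pfst p = (THE x. \<exists>y. p = pair x y)"

definition psnd :: "'u::set_universe \<Rightarrow> 'u" where
  "psnd p = (THE y. \<exists>x. p = pair x y)"

definition prodset :: "'u::set_universe set \<Rightarrow> 'u set \<Rightarrow> 'u set" (infixr "\<boxtimes>" 80) where
  "X \<boxtimes> Y = {pair x y | x y. x \<in> X \<and> y \<in> Y}"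

text \<open>A map on \<open>X\<close>, as an element of the universe, is its graph.\<close>

definition fun_code :: "'u::set_universe set \<Rightarrow> ('u \<Rightarrow> 'u) \<Rightarrow> 'u" where
  "fun_code X f = set_code ((\<lambda>x. pair x (f x)) ` X)"

definition fun_app :: "'u::set_universe \<Rightarrow> 'u \<Rightarrow> 'u" where
  "fun_app p x = (THE y. pair x y \<in> elts p)"

definition is_weak_pullback ::
  "'u::set_universe set \<Rightarrow> 'u set \<Rightarrow> 'u set \<Rightarrow> 'u set \<Rightarrow>
   ('u \<Rightarrow> 'u) \<Rightarrow> ('u \<Rightarrow> 'u) \<Rightarrow> ('u \<Rightarrow> 'u) \<Rightarrow> ('u \<Rightarrow> 'u) \<Rightarrow> bool" where
  "is_weak_pullback P A B C p q f g \<longleftrightarrow>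
     p \<in> P \<rightarrow> A \<and> q \<in> P \<rightarrow> B \<and> f \<in> A \<rightarrow> C \<and> g \<in> B \<rightarrow> C \<and>
     (\<forall>w\<in>P. f (p w) = g (q w)) \<and>
     (\<forall>(Q :: 'u set) u v. small Q \<and> u \<in> Q \<rightarrow> A \<and> v \<in> Q \<rightarrow> B \<and> (\<forall>x\<in>Q. f (u x) = g (v x)) \<longrightarrow>
        (\<exists>w \<in> Q \<rightarrow> P. \<forall>x\<in>Q. p (w x) = u x \<and> q (w x) = v x))"

definition is_pullback ::
  "'u::set_universe set \<Rightarrow> 'u set \<Rightarrow> 'u set \<Rightarrow> 'u set \<Rightarrow>
   ('u \<Rightarrow> 'u) \<Rightarrow> ('u \<Rightarrow> 'u) \<Rightarrow> ('u \<Rightarrow> 'u) \<Rightarrow> ('u \<Rightarrow> 'u) \<Rightarrow> bool" where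
  "is_pullback P A B C p q f g \<longleftrightarrow>
     is_weak_pullback P A B C p q f g \<and>
     (\<forall>(Q :: 'u set) w w'. small Q \<and> w \<in> Q \<rightarrow> P \<and> w' \<in> Q \<rightarrow> P \<and>
        (\<forall>x\<in>Q. p (w x) = p (w' x) \<and> q (w x) = q (w' x)) \<longrightarrow> (\<forall>x\<in>Q. w x = w' x))"


section \<open>Quantales and strict topological theories\<close>

text \<open>The tensor is written as multiplication, its unit \<open>k\<close> as \<open>1\<close>.\<close>

class comm_quantale = complete_lattice + comm_monoid_mult +
  assumes mult_Sup: "x * Sup A = (SUP a\<in>A. x * a)"

definition qhom :: "'v::comm_quantale \<Rightarrow> 'v \<Rightarrow> 'v" where
  "qhom y z = Sup {x. x * y \<le> z}"

text \<open>The action of a functor on a map takes the domain and the codomain of the map as arguments.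
  The quantale is a type; the injection \<open>vel\<close> makes it an object of Set.\<close>

record 'u set_monad =
  Tob :: "'u set \<Rightarrow> 'u set"
  Tar :: "'u set \<Rightarrow> 'u set \<Rightarrow> ('u \<Rightarrow> 'u) \<Rightarrow> 'u \<Rightarrow> 'u"
  Tmult :: "'u set \<Rightarrow> 'u \<Rightarrow> 'u"
  Tunit :: "'u set \<Rightarrow> 'u \<Rightarrow> 'u"

record ('u, 'v) top_theory = "'u set_monad" +
  vel :: "'v \<Rightarrow> 'u"
  xi :: "'u \<Rightarrow> 'v"

definition monad_on_Set :: "('u::set_universe, 'm) set_monad_scheme \<Rightarrow> bool" where
  "monad_on_Set M \<longleftrightarrow>
     (\<forall>X. small X \<longrightarrow> small (Tob M X)) \<and>
     (\<forall>X Y f. small X \<and> small Y \<and> f \<in> X \<rightarrow> Y \<longrightarrow> Tar M X Y f \<in> Tob M X \<rightarrow> Tob M Y) \<and>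
     (\<forall>X Y f g. small X \<and> small Y \<and> f \<in> X \<rightarrow> Y \<and> (\<forall>x\<in>X. f x = g x) \<longrightarrow>
        (\<forall>t \<in> Tob M X. Tar M X Y f t = Tar M X Y g t)) \<and>
     (\<forall>X. small X \<longrightarrow> (\<forall>t \<in> Tob M X. Tar M X X (\<lambda>x. x) t = t)) \<and>
     (\<forall>X Y Z f g. small X \<and> small Y \<and> small Z \<and> f \<in> X \<rightarrow> Y \<and> g \<in> Y \<rightarrow> Z \<longrightarrow>
        (\<forall>t \<in> Tob M X. Tar M X Z (\<lambda>x. g (f x)) t = Tar M Y Z g (Tar M X Y f t))) \<and>
     (\<forall>X. small X \<longrightarrow> Tunit M X \<in> X \<rightarrow> Tob M X) \<and>
     (\<forall>X. small X \<longrightarrow> Tmult M X \<in> Tob M (Tob M X) \<rightarrow> Tob M X) \<and>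
     (\<forall>X Y f. small X \<and> small Y \<and> f \<in> X \<rightarrow> Y \<longrightarrow>
        (\<forall>x\<in>X. Tar M X Y f (Tunit M X x) = Tunit M Y (f x))) \<and>
     (\<forall>X Y f. small X \<and> small Y \<and> f \<in> X \<rightarrow> Y \<longrightarrow>
        (\<forall>t \<in> Tob M (Tob M X).
           Tar M X Y f (Tmult M X t) = Tmult M Y (Tar M (Tob M X) (Tob M Y) (Tar M X Y f) t))) \<and>
     (\<forall>X. small X \<longrightarrow> (\<forall>t \<in> Tob M X. Tmult M X (Tunit M (Tob M X) t) = t)) \<and>
     (\<forall>X. small X \<longrightarrow> (\<forall>t \<in> Tob M X. Tmult M X (Tar M X (Tob M X) (Tunit M X) t) = t)) \<and>
     (\<forall>X. small X \<longrightarrow> (\<forall>t \<in> Tob M (Tob M (Tob M X)).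
        Tmult M X (Tmult M (Tob M X) t) =
        Tmult M X (Tar M (Tob M (Tob M X)) (Tob M X) (Tmult M X) t)))"

definition T_algebra ::
  "('u::set_universe, 'm) set_monad_scheme \<Rightarrow> 'u set \<Rightarrow> ('u \<Rightarrow> 'u) \<Rightarrow> bool" where
  "T_algebra M I \<alpha> \<longleftrightarrow>
     small I \<and> \<alpha> \<in> Tob M I \<rightarrow> I \<and>
     (\<forall>i\<in>I. \<alpha> (Tunit M I i) = i) \<and>
     (\<forall>t \<in> Tob M (Tob M I). \<alpha> (Tmult M I t) = \<alpha> (Tar M (Tob M I) I \<alpha> t))"

definition Vset :: "('u, 'v) top_theory \<Rightarrow> 'u set" where
  "Vset \<T> = range (vel \<T>)"

definition val :: "('u, 'v) top_theory \<Rightarrow> 'u \<Rightarrow> 'v" where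
  "val \<T> = inv (vel \<T>)"

text \<open>The map \<open>\<xi>\<^sub>X\<close>, sending \<open>\<phi>\<close> to \<open>\<xi> \<cdot> T\<phi>\<close>.\<close>

definition xi_ext :: "('u, 'v) top_theory \<Rightarrow> 'u set \<Rightarrow> ('u \<Rightarrow> 'v) \<Rightarrow> 'u \<Rightarrow> 'v" where
  "xi_ext \<T> X \<phi> t = xi \<T> (Tar \<T> X (Vset \<T>) (\<lambda>x. vel \<T> (\<phi> x)) t)"

definition PV :: "'u set \<Rightarrow> ('u \<Rightarrow> 'u) \<Rightarrow> ('u \<Rightarrow> 'v::comm_quantale) \<Rightarrow> 'u \<Rightarrow> 'v" where
  "PV X f \<phi> y = Sup {\<phi> x | x. x \<in> X \<and> f x = y}"

definition strict_top_theory :: "('u::set_universe, 'v::comm_quantale) top_theory \<Rightarrow> bool" where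
  "strict_top_theory \<T> \<longleftrightarrow>
     monad_on_Set \<T> \<and> inj (vel \<T>) \<and> small (Vset \<T>) \<and>
     (\<forall>P A B C p q f g.
        small P \<and> small A \<and> small B \<and> small C \<and> is_pullback P A B C p q f g \<longrightarrow>
        is_weak_pullback (Tob \<T> P) (Tob \<T> A) (Tob \<T> B) (Tob \<T> C)
          (Tar \<T> P A p) (Tar \<T> P B q) (Tar \<T> A C f) (Tar \<T> B C g)) \<and>
     (\<forall>X Y f. small X \<and> small Y \<and> f \<in> X \<rightarrow> Y \<longrightarrow>
        is_weak_pullback (Tob \<T> (Tob \<T> X)) (Tob \<T> X) (Tob \<T> (Tob \<T> Y)) (Tob \<T> Y)
          (Tmult \<T> X) (Tar \<T> (Tob \<T> X) (Tob \<T> Y) (Tar \<T> X Y f))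
          (Tar \<T> X Y f) (Tmult \<T> Y)) \<and>
     T_algebra \<T> (Vset \<T>) (\<lambda>t. vel \<T> (xi \<T> t)) \<and>
     (\<forall>w \<in> Tob \<T> (Vset \<T> \<boxtimes> Vset \<T>).
        xi_ext \<T> (Vset \<T> \<boxtimes> Vset \<T>) (\<lambda>p. val \<T> (pfst p) * val \<T> (psnd p)) w =
        xi \<T> (Tar \<T> (Vset \<T> \<boxtimes> Vset \<T>) (Vset \<T>) pfst w) *
        xi \<T> (Tar \<T> (Vset \<T> \<boxtimes> Vset \<T>) (Vset \<T>) psnd w)) \<and>
     (\<forall>p. \<forall>t \<in> Tob \<T> {p}. xi_ext \<T> {p} (\<lambda>_. 1) t = 1) \<and>
     (\<forall>X \<phi> \<psi>. small X \<and> (\<forall>x\<in>X. \<phi> x \<le> \<psi> x) \<longrightarrow>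
        (\<forall>t \<in> Tob \<T> X. xi_ext \<T> X \<phi> t \<le> xi_ext \<T> X \<psi> t)) \<and>
     (\<forall>X Y f \<phi>. small X \<and> small Y \<and> f \<in> X \<rightarrow> Y \<longrightarrow>
        (\<forall>t \<in> Tob \<T> Y.
           xi_ext \<T> Y (PV X f \<phi>) t = PV (Tob \<T> X) (Tar \<T> X Y f) (xi_ext \<T> X \<phi>) t))"

definition T_one_eq_one :: "('u::set_universe, 'm) set_monad_scheme \<Rightarrow> bool" where
  "T_one_eq_one M \<longleftrightarrow> (\<forall>p. \<exists>q. Tob M {p} = {q})"


section \<open>Quantale-enriched categories\<close>

text \<open>Only the values of structure maps on the carriers are significant.\<close>

record ('a, 'v) vgraph =
  vcar :: "'a set"
  vhom :: "'a \<Rightarrow> 'a \<Rightarrow> 'v"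

definition v_category :: "('a, 'v::comm_quantale) vgraph \<Rightarrow> bool" where
  "v_category A \<longleftrightarrow>
     (\<forall>x \<in> vcar A. 1 \<le> vhom A x x) \<and>
     (\<forall>x \<in> vcar A. \<forall>y \<in> vcar A. \<forall>z \<in> vcar A. vhom A x y * vhom A y z \<le> vhom A x z)"

definition v_functor ::
  "('a, 'v::comm_quantale) vgraph \<Rightarrow> ('b, 'v) vgraph \<Rightarrow> ('a \<Rightarrow> 'b) \<Rightarrow> bool" where
  "v_functor A B f \<longleftrightarrow>
     f \<in> vcar A \<rightarrow> vcar B \<and>
     (\<forall>x \<in> vcar A. \<forall>y \<in> vcar A. vhom A x y \<le> vhom B (f x) (f y))"

text \<open>Distributors \<open>1 \<rightarrow> A\<close> and \<open>I \<rightarrow> 1\<close>, respectively.\<close>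

definition dist_from_one :: "('a, 'v::comm_quantale) vgraph \<Rightarrow> ('a \<Rightarrow> 'v) \<Rightarrow> bool" where
  "dist_from_one A \<phi> \<longleftrightarrow> (\<forall>x \<in> vcar A. \<forall>y \<in> vcar A. vhom A x y * \<phi> y \<le> \<phi> x)"

definition dist_to_one :: "('a, 'v::comm_quantale) vgraph \<Rightarrow> ('a \<Rightarrow> 'v) \<Rightarrow> bool" where
  "dist_to_one I \<phi> \<longleftrightarrow> (\<forall>i \<in> vcar I. \<forall>j \<in> vcar I. \<phi> i * vhom I i j \<le> \<phi> j)"

definition presheaves :: "('a, 'v::comm_quantale) vgraph \<Rightarrow> ('a \<Rightarrow> 'v, 'v) vgraph" where
  "presheaves A = \<lparr>vcar = {\<phi> \<in> extensional (vcar A). dist_from_one A \<phi>},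
                   vhom = \<lambda>\<phi> \<phi>'. INF x\<in>vcar A. qhom (\<phi> x) (\<phi>' x)\<rparr>"

definition is_sup :: "('a, 'v::comm_quantale) vgraph \<Rightarrow> ('a \<Rightarrow> 'v) \<Rightarrow> 'a \<Rightarrow> bool" where
  "is_sup A \<phi> s \<longleftrightarrow>
     s \<in> vcar A \<and>
     (\<forall>y \<in> vcar A. vhom A s y = (INF x\<in>vcar A. qhom (\<phi> x) (vhom A x y)))"

definition is_colimit ::
  "('a, 'v::comm_quantale) vgraph \<Rightarrow> ('i, 'v) vgraph \<Rightarrow> ('i \<Rightarrow> 'v) \<Rightarrow> ('i \<Rightarrow> 'a) \<Rightarrow> 'a \<Rightarrow> bool" where
  "is_colimit A I \<psi> h c \<longleftrightarrow>
     c \<in> vcar A \<and>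
     (\<forall>y \<in> vcar A. vhom A c y = (INF i\<in>vcar I. qhom (\<psi> i) (vhom A (h i) y)))"

definition is_limit ::
  "('a, 'v::comm_quantale) vgraph \<Rightarrow> ('i, 'v) vgraph \<Rightarrow> ('i \<Rightarrow> 'v) \<Rightarrow> ('i \<Rightarrow> 'a) \<Rightarrow> 'a \<Rightarrow> bool" where
  "is_limit A I \<phi> h l \<longleftrightarrow>
     l \<in> vcar A \<and>
     (\<forall>y \<in> vcar A. vhom A y l = (INF i\<in>vcar I. qhom (\<phi> i) (vhom A y (h i))))"

definition is_tensor :: "('a, 'v::comm_quantale) vgraph \<Rightarrow> 'v \<Rightarrow> 'a \<Rightarrow> 'a \<Rightarrow> bool" where
  "is_tensor A v x t \<longleftrightarrow> t \<in> vcar A \<and> (\<forall>y \<in> vcar A. vhom A t y = qhom v (vhom A x y))"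

definition small_v_category :: "('u::set_universe, 'v::comm_quantale) vgraph \<Rightarrow> bool" where
  "small_v_category I \<longleftrightarrow> small (vcar I) \<and> v_category I"

definition v_complete :: "('u::set_universe, 'v::comm_quantale) vgraph \<Rightarrow> bool" where
  "v_complete A \<longleftrightarrow>
     (\<forall>(I :: ('u, 'v) vgraph) \<phi> h.
        small_v_category I \<and> dist_to_one I \<phi> \<and> v_functor I A h \<longrightarrow> (\<exists>l. is_limit A I \<phi> h l))"

definition preserves_limits ::
  "('u::set_universe, 'v::comm_quantale) vgraph \<Rightarrow> ('u, 'v) vgraph \<Rightarrow> ('u \<Rightarrow> 'u) \<Rightarrow> bool" where
  "preserves_limits A B f \<longleftrightarrow>
     (\<forall>(I :: ('u, 'v) vgraph) \<phi> h l.
        small_v_category I \<and> dist_to_one I \<phi> \<and> v_functor I A h \<and> is_limit A I \<phi> h l \<longrightarrow>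
        is_limit B I \<phi> (\<lambda>i. f (h i)) (f l))"


section \<open>Graphs and categories over a theory\<close>

record ('u, 'v) tgraph =
  tcar :: "'u set"
  tstr :: "'u \<Rightarrow> 'u \<Rightarrow> 'v"

text \<open>The extension of a matrix from \<open>X\<close> to \<open>Y\<close>; such a matrix is a map on \<open>Y \<times> X\<close>.\<close>

definition T_xi ::
  "('u::set_universe, 'v::comm_quantale) top_theory \<Rightarrow> 'u set \<Rightarrow> 'u set \<Rightarrow> ('u \<Rightarrow> 'u \<Rightarrow> 'v) \<Rightarrow>
   'u \<Rightarrow> 'u \<Rightarrow> 'v" where
  "T_xi \<T> X Y r \<yy> \<xx> =
     Sup {xi_ext \<T> (Y \<boxtimes> X) (\<lambda>p. r (pfst p) (psnd p)) w | w.
            w \<in> Tob \<T> (Y \<boxtimes> X) \<and> Tar \<T> (Y \<boxtimes> X) Y pfst w = \<yy> \<and> Tar \<T> (Y \<boxtimes> X) X psnd w = \<xx>}"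

definition T_graph ::
  "('u::set_universe, 'v::comm_quantale) top_theory \<Rightarrow> ('u, 'v) tgraph \<Rightarrow> bool" where
  "T_graph \<T> X \<longleftrightarrow> small (tcar X) \<and> (\<forall>x \<in> tcar X. 1 \<le> tstr X (Tunit \<T> (tcar X) x) x)"

definition T_category ::
  "('u::set_universe, 'v::comm_quantale) top_theory \<Rightarrow> ('u, 'v) tgraph \<Rightarrow> bool" where
  "T_category \<T> X \<longleftrightarrow>
     T_graph \<T> X \<and>
     (\<forall>\<XX> \<in> Tob \<T> (Tob \<T> (tcar X)). \<forall>\<yy> \<in> Tob \<T> (tcar X). \<forall>x \<in> tcar X.
        T_xi \<T> (tcar X) (Tob \<T> (tcar X)) (tstr X) \<XX> \<yy> * tstr X \<yy> x
          \<le> tstr X (Tmult \<T> (tcar X) \<XX>) x)"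

definition T_morphism ::
  "('u::set_universe, 'v::comm_quantale) top_theory \<Rightarrow> ('u, 'v) tgraph \<Rightarrow> ('u, 'v) tgraph \<Rightarrow>
   ('u \<Rightarrow> 'u) \<Rightarrow> bool" where
  "T_morphism \<T> X Y f \<longleftrightarrow>
     f \<in> tcar X \<rightarrow> tcar Y \<and>
     (\<forall>\<xx> \<in> Tob \<T> (tcar X). \<forall>x \<in> tcar X.
        tstr X \<xx> x \<le> tstr Y (Tar \<T> (tcar X) (tcar Y) f \<xx>) (f x))"

text \<open>The restriction to the carrier makes equality of records equality of \<open>V\<close>-graphs.\<close>

definition underlying ::
  "('u::set_universe, 'v::comm_quantale) top_theory \<Rightarrow> ('u, 'v) tgraph \<Rightarrow> ('u, 'v) vgraph" where
  "underlying \<T> X =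
     \<lparr>vcar = tcar X, vhom = \<lambda>x'\<in>tcar X. \<lambda>x\<in>tcar X. tstr X (Tunit \<T> (tcar X) x') x\<rparr>"

definition algebra_graph :: "'u set \<Rightarrow> ('u \<Rightarrow> 'u) \<Rightarrow> ('u, 'v::comm_quantale) tgraph" where
  "algebra_graph I \<alpha> = \<lparr>tcar = I, tstr = \<lambda>t i. if \<alpha> t = i then 1 else bot\<rparr>"

definition V_graph :: "('u, 'v::comm_quantale) top_theory \<Rightarrow> ('u, 'v) tgraph" where
  "V_graph \<T> = \<lparr>tcar = Vset \<T>, tstr = \<lambda>t v. qhom (xi \<T> t) (val \<T> v)\<rparr>"


section \<open>Frames over a theory\<close>

text \<open>The map \<open>t\<close> is a choice of the tensors of \<open>\<psi> i\<close> and \<open>h i\<close>.\<close>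

definition T_weighted_diagram ::
  "('u::set_universe, 'v::comm_quantale) top_theory \<Rightarrow> ('u, 'v) tgraph \<Rightarrow>
   ('u, 'v) vgraph \<Rightarrow> ('u \<Rightarrow> 'v) \<Rightarrow> ('u \<Rightarrow> 'u) \<Rightarrow> bool" where
  "T_weighted_diagram \<T> A I \<psi> h \<longleftrightarrow>
     small_v_category I \<and> v_functor I (underlying \<T> A) h \<and> dist_from_one I \<psi> \<and>
     (\<exists>\<alpha> t. T_algebra \<T> (vcar I) \<alpha> \<and>
        (\<forall>i \<in> vcar I. is_tensor (underlying \<T> A) (\<psi> i) (h i) (t i)) \<and>
        T_morphism \<T> (algebra_graph (vcar I) \<alpha>) A t)"

definition T_generated ::
  "('u::set_universe, 'v::comm_quantale) top_theory \<Rightarrow> ('u, 'v) tgraph \<Rightarrow> ('u \<Rightarrow> 'v) \<Rightarrow> bool" where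
  "T_generated \<T> A \<phi> \<longleftrightarrow>
     dist_from_one (underlying \<T> A) \<phi> \<and>
     (\<exists>I \<psi> h. T_weighted_diagram \<T> A I \<psi> h \<and>
        (\<forall>x \<in> tcar A. \<phi> x = (SUP i\<in>vcar I. vhom (underlying \<T> A) x (h i) * \<psi> i)))"

definition T_frame ::
  "('u::set_universe, 'v::comm_quantale) top_theory \<Rightarrow> ('u, 'v) tgraph \<Rightarrow> bool" where
  "T_frame \<T> A \<longleftrightarrow>
     T_graph \<T> A \<and> v_category (underlying \<T> A) \<and> v_complete (underlying \<T> A) \<and>
     (\<forall>(I :: ('u, 'v) vgraph) \<phi> h l s c.
        small_v_category I \<and> dist_to_one I \<phi> \<and>
        v_functor I (presheaves (underlying \<T> A)) h \<and>
        (\<forall>i \<in> vcar I. T_generated \<T> A (h i)) \<and>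
        is_limit (presheaves (underlying \<T> A)) I \<phi> h l \<and> T_generated \<T> A l \<and>
        (\<forall>i \<in> vcar I. is_sup (underlying \<T> A) (h i) (s i)) \<and> is_sup (underlying \<T> A) l c \<longrightarrow>
        is_limit (underlying \<T> A) I \<phi> s c)"

definition T_compatible ::
  "('u::set_universe, 'v::comm_quantale) top_theory \<Rightarrow> ('u, 'v) tgraph \<Rightarrow> ('u, 'v) tgraph \<Rightarrow>
   ('u \<Rightarrow> 'u) \<Rightarrow> bool" where
  "T_compatible \<T> A B f \<longleftrightarrow>
     (\<forall>I \<alpha> h. T_algebra \<T> I \<alpha> \<and> T_morphism \<T> (algebra_graph I \<alpha>) A h \<longrightarrow>
        T_morphism \<T> (algebra_graph I \<alpha>) B (\<lambda>i. f (h i)))"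

definition preserves_T_weighted_colimits ::
  "('u::set_universe, 'v::comm_quantale) top_theory \<Rightarrow> ('u, 'v) tgraph \<Rightarrow> ('u, 'v) tgraph \<Rightarrow>
   ('u \<Rightarrow> 'u) \<Rightarrow> bool" where
  "preserves_T_weighted_colimits \<T> A B f \<longleftrightarrow>
     (\<forall>I \<psi> h c. T_weighted_diagram \<T> A I \<psi> h \<and> is_colimit (underlying \<T> A) I \<psi> h c \<longrightarrow>
        is_colimit (underlying \<T> B) I \<psi> (\<lambda>i. f (h i)) (f c))"

definition T_frame_hom ::
  "('u::set_universe, 'v::comm_quantale) top_theory \<Rightarrow> ('u, 'v) tgraph \<Rightarrow> ('u, 'v) tgraph \<Rightarrow>
   ('u \<Rightarrow> 'u) \<Rightarrow> bool" where
  "T_frame_hom \<T> A B f \<longleftrightarrow>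
     v_functor (underlying \<T> A) (underlying \<T> B) f \<and> T_compatible \<T> A B f \<and>
     preserves_limits (underlying \<T> A) (underlying \<T> B) f \<and>
     preserves_T_weighted_colimits \<T> A B f"


section \<open>Categories and functors\<close>

record ('o, 'm) cat =
  Obj :: "'o set"
  Mor :: "'o \<Rightarrow> 'o \<Rightarrow> 'm set"
  Idn :: "'o \<Rightarrow> 'm"
  Cmp :: "'o \<Rightarrow> 'o \<Rightarrow> 'o \<Rightarrow> 'm \<Rightarrow> 'm \<Rightarrow> 'm"

text \<open>\<open>Cmp C X Y Z g f\<close> is the composite of \<open>f : X \<rightarrow> Y\<close> and \<open>g : Y \<rightarrow> Z\<close>.\<close>

definition is_category :: "('o, 'm) cat \<Rightarrow> bool" where
  "is_category C \<longleftrightarrow>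
     (\<forall>X \<in> Obj C. Idn C X \<in> Mor C X X) \<and>
     (\<forall>X \<in> Obj C. \<forall>Y \<in> Obj C. \<forall>Z \<in> Obj C. \<forall>f \<in> Mor C X Y. \<forall>g \<in> Mor C Y Z.
        Cmp C X Y Z g f \<in> Mor C X Z) \<and>
     (\<forall>X \<in> Obj C. \<forall>Y \<in> Obj C. \<forall>f \<in> Mor C X Y.
        Cmp C X X Y f (Idn C X) = f \<and> Cmp C X Y Y (Idn C Y) f = f) \<and>
     (\<forall>W \<in> Obj C. \<forall>X \<in> Obj C. \<forall>Y \<in> Obj C. \<forall>Z \<in> Obj C.
        \<forall>f \<in> Mor C W X. \<forall>g \<in> Mor C X Y. \<forall>h \<in> Mor C Y Z.
        Cmp C W X Z (Cmp C X Y Z h g) f = Cmp C W Y Z h (Cmp C W X Y g f))"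

definition opposite :: "('o, 'm) cat \<Rightarrow> ('o, 'm) cat" where
  "opposite C = \<lparr>Obj = Obj C, Mor = \<lambda>X Y. Mor C Y X, Idn = Idn C,
                 Cmp = \<lambda>X Y Z g f. Cmp C Z Y X f g\<rparr>"

record ('o, 'm, 'p, 'n) functr =
  on_ob :: "'o \<Rightarrow> 'p"
  on_mor :: "'o \<Rightarrow> 'o \<Rightarrow> 'm \<Rightarrow> 'n"

definition is_functor :: "('o, 'm) cat \<Rightarrow> ('p, 'n) cat \<Rightarrow> ('o, 'm, 'p, 'n) functr \<Rightarrow> bool" where
  "is_functor C D F \<longleftrightarrow>
     is_category C \<and> is_category D \<and>
     (\<forall>X \<in> Obj C. on_ob F X \<in> Obj D) \<and>
     (\<forall>X \<in> Obj C. \<forall>Y \<in> Obj C. \<forall>f \<in> Mor C X Y.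
        on_mor F X Y f \<in> Mor D (on_ob F X) (on_ob F Y)) \<and>
     (\<forall>X \<in> Obj C. on_mor F X X (Idn C X) = Idn D (on_ob F X)) \<and>
     (\<forall>X \<in> Obj C. \<forall>Y \<in> Obj C. \<forall>Z \<in> Obj C. \<forall>f \<in> Mor C X Y. \<forall>g \<in> Mor C Y Z.
        on_mor F X Z (Cmp C X Y Z g f) =
        Cmp D (on_ob F X) (on_ob F Y) (on_ob F Z) (on_mor F Y Z g) (on_mor F X Y f))"

definition functor_comp ::
  "('p, 'n, 'q, 'l) functr \<Rightarrow> ('o, 'm, 'p, 'n) functr \<Rightarrow> ('o, 'm, 'q, 'l) functr" where
  "functor_comp G F = \<lparr>on_ob = \<lambda>X. on_ob G (on_ob F X),
                       on_mor = \<lambda>X Y f. on_mor G (on_ob F X) (on_ob F Y) (on_mor F X Y f)\<rparr>"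

definition functor_eq ::
  "('o, 'm) cat \<Rightarrow> ('o, 'm, 'p, 'n) functr \<Rightarrow> ('o, 'm, 'p, 'n) functr \<Rightarrow> bool" where
  "functor_eq C F G \<longleftrightarrow>
     (\<forall>X \<in> Obj C. on_ob F X = on_ob G X) \<and>
     (\<forall>X \<in> Obj C. \<forall>Y \<in> Obj C. \<forall>f \<in> Mor C X Y. on_mor F X Y f = on_mor G X Y f)"

text \<open>In the categories below, morphisms are extensional functions on the carriers.\<close>

definition TCat ::
  "('u::set_universe, 'v::comm_quantale) top_theory \<Rightarrow> (('u, 'v) tgraph, 'u \<Rightarrow> 'u) cat" where
  "TCat \<T> = \<lparr>Obj = {X. T_category \<T> X},
             Mor = \<lambda>X Y. {f \<in> extensional (tcar X). T_morphism \<T> X Y f},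
             Idn = \<lambda>X. \<lambda>x\<in>tcar X. x,
             Cmp = \<lambda>X Y Z g f. compose (tcar X) g f\<rparr>"

definition VCont :: "(('u::set_universe, 'v::comm_quantale) vgraph, 'u \<Rightarrow> 'u) cat" where
  "VCont = \<lparr>Obj = {A. small_v_category A \<and> v_complete A},
            Mor = \<lambda>A B. {f \<in> extensional (vcar A). v_functor A B f \<and> preserves_limits A B f},
            Idn = \<lambda>A. \<lambda>x\<in>vcar A. x,
            Cmp = \<lambda>A B C g f. compose (vcar A) g f\<rparr>"

definition TFrm ::
  "('u::set_universe, 'v::comm_quantale) top_theory \<Rightarrow> (('u, 'v) tgraph, 'u \<Rightarrow> 'u) cat" where
  "TFrm \<T> = \<lparr>Obj = {A. T_frame \<T> A},
             Mor = \<lambda>A B. {f \<in> extensional (tcar A). T_frame_hom \<T> A B f},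
             Idn = \<lambda>A. \<lambda>x\<in>tcar A. x,
             Cmp = \<lambda>A B C g f. compose (tcar A) g f\<rparr>"

definition forgetful ::
  "('u::set_universe, 'v::comm_quantale) top_theory \<Rightarrow>
   (('u, 'v) tgraph, 'u \<Rightarrow> 'u, ('u, 'v) vgraph, 'u \<Rightarrow> 'u) functr" where
  "forgetful \<T> = \<lparr>on_ob = underlying \<T>, on_mor = \<lambda>A B f. f\<rparr>"


section \<open>The function spaces into the quantale\<close>

text \<open>The elements of \<open>V\<^sup>X\<close> are the graphs of the functors \<open>X \<rightarrow> V\<close>, so that \<open>V\<^sup>X\<close>
  is again an object of Set; \<open>ap\<close> recovers the values.\<close>

definition Vpow_set ::
  "('u::set_universe, 'v::comm_quantale) top_theory \<Rightarrow> ('u, 'v) tgraph \<Rightarrow> 'u set" where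
  "Vpow_set \<T> X = {fun_code (tcar X) f | f. T_morphism \<T> X (V_graph \<T>) f}"

definition ap :: "('u::set_universe, 'v) top_theory \<Rightarrow> 'u \<Rightarrow> 'u \<Rightarrow> 'v" where
  "ap \<T> \<phi> x = val \<T> (fun_app \<phi> x)"

definition Vpow_vcat ::
  "('u::set_universe, 'v::comm_quantale) top_theory \<Rightarrow> ('u, 'v) tgraph \<Rightarrow> ('u, 'v) vgraph" where
  "Vpow_vcat \<T> X =
     \<lparr>vcar = Vpow_set \<T> X,
      vhom = \<lambda>\<phi>'\<in>Vpow_set \<T> X. \<lambda>\<phi>\<in>Vpow_set \<T> X. INF x\<in>tcar X. qhom (ap \<T> \<phi>' x) (ap \<T> \<phi> x)\<rparr>"

definition Vpow_tgraph ::
  "('u::set_universe, 'v::comm_quantale) top_theory \<Rightarrow> ('u, 'v) tgraph \<Rightarrow> ('u, 'v) tgraph" where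
  "Vpow_tgraph \<T> X =
     \<lparr>tcar = Vpow_set \<T> X,
      tstr = \<lambda>\<pp> \<phi>.
        let D = tcar X \<boxtimes> Vpow_set \<T> X in
        Inf {qhom (tstr X (Tar \<T> D (tcar X) pfst \<qq>) x)
               (qhom (xi_ext \<T> D (\<lambda>p. ap \<T> (psnd p) (pfst p)) \<qq>) (ap \<T> \<phi> x)) | x \<qq>.
             x \<in> tcar X \<and> \<qq> \<in> Tob \<T> D \<and> Tar \<T> D (Vpow_set \<T> X) psnd \<qq> = \<pp>}\<rparr>"

text \<open>For \<open>f : X \<rightarrow> Y\<close>, the map \<open>V\<^sup>Y \<rightarrow> V\<^sup>X\<close> sending \<open>\<phi>\<close> to \<open>\<phi> \<cdot> f\<close>.\<close>

definition Vpow_map ::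
  "('u::set_universe, 'v::comm_quantale) top_theory \<Rightarrow> ('u, 'v) tgraph \<Rightarrow> ('u, 'v) tgraph \<Rightarrow>
   ('u \<Rightarrow> 'u) \<Rightarrow> 'u \<Rightarrow> 'u" where
  "Vpow_map \<T> X Y f = (\<lambda>\<phi>\<in>Vpow_set \<T> Y. fun_code (tcar X) (\<lambda>x. fun_app \<phi> (f x)))"

text \<open>Functors on the opposite category: a morphism from \<open>Y\<close> to \<open>X\<close> there is some
  \<open>f : X \<rightarrow> Y\<close>.\<close>

definition Vpow ::
  "('u::set_universe, 'v::comm_quantale) top_theory \<Rightarrow>
   (('u, 'v) tgraph, 'u \<Rightarrow> 'u, ('u, 'v) vgraph, 'u \<Rightarrow> 'u) functr" where
  "Vpow \<T> = \<lparr>on_ob = Vpow_vcat \<T>, on_mor = \<lambda>Y X f. Vpow_map \<T> X Y f\<rparr>"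

definition Omega ::
  "('u::set_universe, 'v::comm_quantale) top_theory \<Rightarrow>
   (('u, 'v) tgraph, 'u \<Rightarrow> 'u, ('u, 'v) tgraph, 'u \<Rightarrow> 'u) functr" where
  "Omega \<T> = \<lparr>on_ob = Vpow_tgraph \<T>, on_mor = \<lambda>Y X f. Vpow_map \<T> X Y f\<rparr>"

end

theory Submission
  imports Defs
begin

text \<open>For \<open>x \<in> X\<close> the map \<open>a(e\<^sub>X(x), -)\<close> is a \<open>\<T>\<close>-functor representing evaluation at \<open>x\<close>, by the
  \<open>\<T>\<close>-category axiom and \<open>T1 = 1\<close>. Naturality of \<open>\<phi> \<mapsto> \<xi> \<cdot> T\<phi>\<close> along the projection \<open>X \<times> I \<rightarrow> X\<close>
  shows that the pointwise supremum of a \<open>\<T>\<close>-weighted diagram in \<open>V\<^sup>X\<close> is again a \<open>\<T>\<close>-functor. Hence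
  the supremum of a \<open>\<T>\<close>-generated \<open>\<Phi>\<close> is \<open>x \<mapsto> \<Phi>(a(e\<^sub>X(x), -))\<close>, and as limits of distributors and of
  functors are both pointwise, suprema commute with them. Precomposition with \<open>f : X \<rightarrow> Y\<close> is a
  \<open>\<T>\<close>-graph morphism because \<open>T\<close> sends the pullback \<open>X \<times> V\<^sup>Y\<close> of \<open>V\<^sup>f\<close> along \<open>X \<times> V\<^sup>X \<rightarrow> V\<^sup>X\<close> to a
  weak pullback, and it preserves everything computed pointwise.\<close>

section \<open>Small sets and pairs\<close>

lemma elts_set_code: "small A \<Longrightarrow> elts (set_code A) = A"
  unfolding small_def set_code_def by (rule f_inv_into_f)

lemma small_elts: "small (elts x)"
  unfolding small_def by blast

lemma small_subset: "small A \<Longrightarrow> B \<subseteq> A \<Longrightarrow> small B"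
  unfolding small_def using elts_subset by auto

lemma small_image:
  fixes f :: "'u::set_universe \<Rightarrow> 'u"
  shows "small A \<Longrightarrow> small (f ` A)"
  unfolding small_def using elts_replacement by auto

lemma small_Pow: "small A \<Longrightarrow> small {y. elts y \<subseteq> A}"
  unfolding small_def using elts_Pow by auto

lemma small_empty: "small {}"
  using small_subset[OF small_elts] by blast

text \<open>The union axiom applies to a set of codes, so replacement first collects the codes of
  the sets \<open>B x\<close> into one element of the universe.\<close>

lemma small_UN:
  fixes B :: "'u::set_universe \<Rightarrow> 'u set"
  assumes "small A" "\<And>x. x \<in> A \<Longrightarrow> small (B x)"
  shows "small (\<Union>x\<in>A. B x)"
proof -
  have "small ((\<lambda>x. set_code (B x)) ` A)" using assms(1) by (rule small_image)
  then obtain c where c: "elts c = (\<lambda>x. set_code (B x)) ` A"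
    unfolding small_def by auto
  have "\<Union> (elts ` elts c) = (\<Union>x\<in>A. B x)"
    unfolding c using elts_set_code[OF assms(2)] by auto
  then show ?thesis unfolding small_def using elts_Union[of c] by simp
qed

text \<open>Pairing comes from replacement applied to the power set of a singleton, which has two
  different elements. The singleton itself is a constant image of the power set of the empty
  set.\<close>

lemma small_doubleton:
  fixes x y :: "'u::set_universe"
  shows "small {x, y}"
proof -
  have "small {z :: 'u. elts z \<subseteq> {}}" by (rule small_Pow[OF small_empty])
  then have "small ((\<lambda>_. set_code {} :: 'u) ` {z :: 'u. elts z \<subseteq> {}})" by (rule small_image)
  moreover have "(\<lambda>_. set_code {} :: 'u) ` {z :: 'u. elts z \<subseteq> {}} = {set_code {}}"
    using elts_set_code[OF small_empty] by auto
  ultimately have s0: "small {set_code {} :: 'u}" by simp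
  let ?P = "{z :: 'u. elts z \<subseteq> {set_code {} :: 'u}}"
  \<comment> \<open>\<open>?g\<close> separates the code of the empty set, sent to \<open>x\<close>,
    from the code of \<open>{set_code {}}\<close>, sent to \<open>y\<close>.\<close>
  let ?g = "\<lambda>z. if elts z = {} then x else y"
  have "small (?g ` ?P)" by (intro small_image small_Pow s0)
  moreover have "set_code {} \<in> ?P" "set_code {set_code {}} \<in> ?P"
    using elts_set_code[OF small_empty] elts_set_code[OF s0] by auto
  then have "{x, y} \<subseteq> ?g ` ?P"
    using elts_set_code[OF small_empty] elts_set_code[OF s0] by (auto simp: image_iff)
  ultimately show ?thesis by (rule small_subset)
qed

lemma small_singleton: "small {x}"
  using small_doubleton[of x x] by simp

lemma set_code_eq_iff: "small A \<Longrightarrow> small B \<Longrightarrow> set_code A = set_code B \<longleftrightarrow> A = B"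
  using elts_set_code by metis

text \<open>These are Kuratowski pairs; their characteristic property survives the coding because
  \<open>set_code\<close> is injective on small sets.\<close>

lemma pair_eq_iff: "pair x y = pair x' y' \<longleftrightarrow> x = x' \<and> y = y'"
  unfolding pair_def
  by (simp add: set_code_eq_iff small_doubleton small_singleton doubleton_eq_iff) blast

lemma pfst_pair [simp]: "pfst (pair x y) = x"
  unfolding pfst_def by (auto simp: pair_eq_iff)

lemma psnd_pair [simp]: "psnd (pair x y) = y"
  unfolding psnd_def by (auto simp: pair_eq_iff)

lemma pair_in_prodset [simp]: "pair x y \<in> X \<boxtimes> Y \<longleftrightarrow> x \<in> X \<and> y \<in> Y"
  unfolding prodset_def by (auto simp: pair_eq_iff)

lemma prodsetE:
  assumes "p \<in> X \<boxtimes> Y"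
  obtains x y where "p = pair x y" "x \<in> X" "y \<in> Y"
  using assms unfolding prodset_def by blast

lemma small_prodset:
  assumes "small X" "small Y"
  shows "small (X \<boxtimes> Y)"
proof -
  have "X \<boxtimes> Y = (\<Union>x\<in>X. pair x ` Y)" unfolding prodset_def by blast
  then show ?thesis using assms by (simp add: small_UN small_image)
qed

lemma elts_fun_code: "small X \<Longrightarrow> elts (fun_code X f) = (\<lambda>x. pair x (f x)) ` X"
  unfolding fun_code_def by (intro elts_set_code small_image)

lemma fun_app_fun_code: "small X \<Longrightarrow> x \<in> X \<Longrightarrow> fun_app (fun_code X f) x = f x"
  unfolding fun_app_def by (auto simp: elts_fun_code pair_eq_iff)

lemma fun_code_cong: "(\<And>x. x \<in> X \<Longrightarrow> f x = g x) \<Longrightarrow> fun_code X f = fun_code X g"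
  unfolding fun_code_def by (metis (no_types, lifting) image_cong)

text \<open>The lifting property is tested on a one-element set, where maps amount to
  elements.\<close>

lemma weak_pullbackE:
  assumes "is_weak_pullback P A B C p q f g" "a \<in> A" "b \<in> B" "f a = g b"
  obtains w where "w \<in> P" "p w = a" "q w = b"
proof -
  have "\<forall>(Q :: 'a set) u v. small Q \<and> u \<in> Q \<rightarrow> A \<and> v \<in> Q \<rightarrow> B \<and> (\<forall>x\<in>Q. f (u x) = g (v x)) \<longrightarrow>
    (\<exists>w \<in> Q \<rightarrow> P. \<forall>x\<in>Q. p (w x) = u x \<and> q (w x) = v x)"
    using assms(1) unfolding is_weak_pullback_def by (elim conjE)
  from this[rule_format, of "{a}" "\<lambda>_. a" "\<lambda>_. b"]
  have "\<exists>w \<in> {a} \<rightarrow> P. \<forall>x\<in>{a}. p (w x) = a \<and> q (w x) = b"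
    using assms(2-) small_singleton[of a] by simp
  then show ?thesis using that by (auto simp: Pi_def)
qed

text \<open>Conversely, elementwise lifts are assembled into a map by choice.\<close>

lemma is_pullbackI:
  assumes "p \<in> P \<rightarrow> A" "q \<in> P \<rightarrow> B" "f \<in> A \<rightarrow> C" "g \<in> B \<rightarrow> C"
    and "\<And>w. w \<in> P \<Longrightarrow> f (p w) = g (q w)"
    and ex: "\<And>a b. a \<in> A \<Longrightarrow> b \<in> B \<Longrightarrow> f a = g b \<Longrightarrow> \<exists>w\<in>P. p w = a \<and> q w = b"
    and inj: "\<And>w w'. w \<in> P \<Longrightarrow> w' \<in> P \<Longrightarrow> p w = p w' \<Longrightarrow> q w = q w' \<Longrightarrow> w = w'"
  shows "is_pullback P A B C p q f g"
  unfolding is_pullback_def is_weak_pullback_def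
proof (intro conjI allI impI ballI)
  fix Q u v
  assume "small Q \<and> u \<in> Q \<rightarrow> A \<and> v \<in> Q \<rightarrow> B \<and> (\<forall>x\<in>Q. f (u x) = g (v x))"
  then have "\<forall>x\<in>Q. \<exists>w. w \<in> P \<and> p w = u x \<and> q w = v x" using ex by (metis PiE)
  then obtain w where "\<forall>x\<in>Q. w x \<in> P \<and> p (w x) = u x \<and> q (w x) = v x" by metis
  then show "\<exists>w\<in>Q \<rightarrow> P. \<forall>x\<in>Q. p (w x) = u x \<and> q (w x) = v x" by (intro bexI[of _ w]) auto
qed (use assms in \<open>auto simp: Pi_def\<close>)


section \<open>Quantales and pointwise enriched categories\<close>

lemma quantale_mult_left_mono:
  fixes a b c :: "'v::comm_quantale"
  assumes "a \<le> b"
  shows "c * a \<le> c * b"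
proof -
  have "c * b = c * Sup {a, b}" using assms by (simp add: sup.absorb2)
  also have "\<dots> = sup (c * a) (c * b)" unfolding mult_Sup by simp
  finally show ?thesis by (metis sup.cobounded1)
qed

lemma quantale_mult_mono:
  fixes a b c d :: "'v::comm_quantale"
  shows "a \<le> b \<Longrightarrow> c \<le> d \<Longrightarrow> a * c \<le> b * d"
  by (metis mult.commute order_trans quantale_mult_left_mono)

lemma mult_SUP: "(x::'v::comm_quantale) * (SUP i\<in>I. f i) = (SUP i\<in>I. x * f i)"
  unfolding mult_Sup by (simp add: image_image)

lemma le_qhom_iff: "x \<le> qhom y z \<longleftrightarrow> x * y \<le> (z::'v::comm_quantale)"
proof
  assume "x \<le> qhom y z"
  then have "y * x \<le> y * Sup {x. x * y \<le> z}"
    unfolding qhom_def by (rule quantale_mult_left_mono)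
  also have "\<dots> \<le> z" unfolding mult_Sup by (rule SUP_least) (simp add: mult.commute)
  finally show "x * y \<le> z" by (simp add: mult.commute)
qed (simp add: qhom_def Sup_upper)

lemma one_le_qhom_iff: "1 \<le> qhom y z \<longleftrightarrow> y \<le> (z::'v::comm_quantale)"
  by (simp add: le_qhom_iff)

text \<open>Equalities between infima or suprema are proved below by comparing lower bounds, since
  \<open>le_qhom_iff\<close> then replaces every \<open>qhom\<close> by a product.\<close>

lemma order_eqI: "(\<And>u. u \<le> a \<longleftrightarrow> u \<le> b) \<Longrightarrow> a = (b::'a::order)"
  by (meson order.antisym order.refl)

lemma le_Inf_Collect_iff:
  "(u :: 'a::complete_lattice) \<le> Inf {f x y | x y. P x y} \<longleftrightarrow> (\<forall>x y. P x y \<longrightarrow> u \<le> f x y)"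
  unfolding le_Inf_iff by blast

section \<open>V-categories whose hom-objects, limits and colimits are pointwise\<close>

text \<open>\<open>E f x\<close> stands for the value of the object \<open>f\<close> at
  \<open>x\<close>. Two instances occur: \<open>V^X\<close> with evaluation \<open>ap\<close>, and
  presheaves, which are functions already.\<close>

definition pointwise_hom ::
  "('a, 'v::comm_quantale) vgraph \<Rightarrow> 'x set \<Rightarrow> ('a \<Rightarrow> 'x \<Rightarrow> 'v) \<Rightarrow> bool" where
  "pointwise_hom A S E \<longleftrightarrow>
     (\<forall>f\<in>vcar A. \<forall>g\<in>vcar A. vhom A f g = (INF x\<in>S. qhom (E f x) (E g x)))"

lemma pointwise_le_vhom_iff:
  assumes "pointwise_hom A S E" "f \<in> vcar A" "g \<in> vcar A"
  shows "u \<le> vhom A f g \<longleftrightarrow> (\<forall>x\<in>S. u * E f x \<le> E g x)"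
  using assms unfolding pointwise_hom_def by (simp add: le_INF_iff le_qhom_iff)

lemma pointwise_v_category:
  assumes "pointwise_hom A S E"
  shows "v_category A"
  unfolding v_category_def
proof (intro conjI ballI)
  fix f g h assume m: "f \<in> vcar A" "g \<in> vcar A" "h \<in> vcar A"
  show "vhom A f g * vhom A g h \<le> vhom A f h"
    unfolding pointwise_le_vhom_iff[OF assms m(1,3)]
  proof
    fix x assume x: "x \<in> S"
    have "vhom A f g * E f x \<le> E g x" "vhom A g h * E g x \<le> E h x"
      using pointwise_le_vhom_iff[OF assms] m x by blast+
    then have "vhom A g h * (vhom A f g * E f x) \<le> E h x"
      using quantale_mult_left_mono order_trans by blast
    then show "vhom A f g * vhom A g h * E f x \<le> E h x"
      by (simp add: mult.assoc mult.left_commute)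
  qed
qed (simp add: pointwise_le_vhom_iff[OF assms])

lemma is_limit_cong:
  "(\<And>i. i \<in> vcar I \<Longrightarrow> h i = h' i) \<Longrightarrow> is_limit A I \<phi> h l \<longleftrightarrow> is_limit A I \<phi> h' l"
  unfolding is_limit_def by (simp cong: INF_cong)

lemma is_colimit_cong:
  "(\<And>i. i \<in> vcar I \<Longrightarrow> h i = h' i) \<Longrightarrow> is_colimit A I \<psi> h c \<longleftrightarrow> is_colimit A I \<psi> h' c"
  unfolding is_colimit_def by (simp cong: INF_cong)

lemma is_sup_iff_colimit: "is_sup A \<phi> s \<longleftrightarrow> is_colimit A A \<phi> (\<lambda>x. x) s"
  unfolding is_sup_def is_colimit_def ..

lemma is_tensor_iff_colimit:
  "vcar I = {p} \<Longrightarrow> is_tensor A v x t \<longleftrightarrow> is_colimit A I (\<lambda>_. v) (\<lambda>_. x) t"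
  unfolding is_tensor_def is_colimit_def by simp

text \<open>For a lower bound \<open>u\<close> both sides express the same family of inequalities;
  only the order of the quantifiers and of the factors \<open>E y x\<close> and
  \<open>\<phi> i\<close> differs.\<close>

lemma pointwise_limitI:
  assumes A: "pointwise_hom A S E" and l: "l \<in> vcar A" and h: "h \<in> vcar I \<rightarrow> vcar A"
    and E: "\<And>x. x \<in> S \<Longrightarrow> E l x = (INF i\<in>vcar I. qhom (\<phi> i) (E (h i) x))"
  shows "is_limit A I \<phi> h l"
  unfolding is_limit_def
proof (intro conjI ballI l)
  fix y assume y: "y \<in> vcar A"
  have hi: "\<And>i. i \<in> vcar I \<Longrightarrow> h i \<in> vcar A" using h by auto
  show "vhom A y l = (INF i\<in>vcar I. qhom (\<phi> i) (vhom A y (h i)))"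
  proof (rule order_eqI)
    fix u
    have "u \<le> vhom A y l \<longleftrightarrow> (\<forall>x\<in>S. \<forall>i\<in>vcar I. u * E y x * \<phi> i \<le> E (h i) x)"
      by (simp add: pointwise_le_vhom_iff[OF A y l] E le_INF_iff le_qhom_iff)
    also have "\<dots> \<longleftrightarrow> (\<forall>x\<in>S. \<forall>i\<in>vcar I. u * \<phi> i * E y x \<le> E (h i) x)"
      by (simp add: ac_simps)
    also have "\<dots> \<longleftrightarrow> u \<le> (INF i\<in>vcar I. qhom (\<phi> i) (vhom A y (h i)))"
      by (auto simp: pointwise_le_vhom_iff[OF A y hi] le_INF_iff le_qhom_iff)
    finally show "u \<le> vhom A y l \<longleftrightarrow> u \<le> (INF i\<in>vcar I. qhom (\<phi> i) (vhom A y (h i)))" .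
  qed
qed

text \<open>Limits are determined only up to isomorphism, so only values can be compared. The homs
  into \<open>l\<close> and \<open>l'\<close> agree; reflexivity then puts both homs between them
  above \<open>1\<close>, which means equal values.\<close>

lemma pointwise_limit_unique:
  assumes A: "pointwise_hom A S E" and l: "is_limit A I \<phi> h l" "is_limit A I \<phi> h l'" and x: "x \<in> S"
  shows "E l x = E l' x"
proof -
  have m: "l \<in> vcar A" "l' \<in> vcar A" using l unfolding is_limit_def by auto
  have "vhom A y l = vhom A y l'" if "y \<in> vcar A" for y
    using l that unfolding is_limit_def by simp
  then have "1 \<le> vhom A l l'" "1 \<le> vhom A l' l"
    using pointwise_v_category[OF A] m unfolding v_category_def by metis+
  then show ?thesis
    using pointwise_le_vhom_iff[OF A] m x by (simp add: order.antisym)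
qed

text \<open>The tensor preserves suprema, so a bound on \<open>u * E c x\<close> splits into one
  inequality for each index.\<close>

lemma pointwise_colimitI:
  assumes A: "pointwise_hom A S E" and c: "c \<in> vcar A" and h: "h \<in> vcar I \<rightarrow> vcar A"
    and E: "\<And>x. x \<in> S \<Longrightarrow> E c x = (SUP i\<in>vcar I. \<psi> i * E (h i) x)"
  shows "is_colimit A I \<psi> h c"
  unfolding is_colimit_def
proof (intro conjI ballI c)
  fix y assume y: "y \<in> vcar A"
  have hi: "\<And>i. i \<in> vcar I \<Longrightarrow> h i \<in> vcar A" using h by auto
  show "vhom A c y = (INF i\<in>vcar I. qhom (\<psi> i) (vhom A (h i) y))"
  proof (rule order_eqI)
    fix u
    have "u \<le> vhom A c y \<longleftrightarrow> (\<forall>x\<in>S. \<forall>i\<in>vcar I. u * (\<psi> i * E (h i) x) \<le> E y x)"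
      by (simp add: pointwise_le_vhom_iff[OF A c y] E mult_SUP SUP_le_iff)
    also have "\<dots> \<longleftrightarrow> u \<le> (INF i\<in>vcar I. qhom (\<psi> i) (vhom A (h i) y))"
      by (auto simp: pointwise_le_vhom_iff[OF A hi y] le_INF_iff le_qhom_iff mult.assoc)
    finally show "u \<le> vhom A c y \<longleftrightarrow> u \<le> (INF i\<in>vcar I. qhom (\<psi> i) (vhom A (h i) y))" .
  qed
qed

lemma pointwise_colimit_unique:
  assumes A: "pointwise_hom A S E" and c: "is_colimit A I \<psi> h c" "is_colimit A I \<psi> h c'"
    and x: "x \<in> S"
  shows "E c x = E c' x"
proof -
  have m: "c \<in> vcar A" "c' \<in> vcar A" using c unfolding is_colimit_def by auto
  have "vhom A c y = vhom A c' y" if "y \<in> vcar A" for y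
    using c that unfolding is_colimit_def by simp
  then have "1 \<le> vhom A c c'" "1 \<le> vhom A c' c"
    using pointwise_v_category[OF A] m unfolding v_category_def by metis+
  then show ?thesis
    using pointwise_le_vhom_iff[OF A] m x by (simp add: order.antisym)
qed

lemma pointwise_hom_presheaves: "pointwise_hom (presheaves A) (vcar A) (\<lambda>\<phi>. \<phi>)"
  unfolding pointwise_hom_def presheaves_def by simp

lemma presheaves_limit:
  assumes h: "h \<in> vcar I \<rightarrow> vcar (presheaves A)" and l: "is_limit (presheaves A) I \<phi> h l"
    and x: "x \<in> vcar A"
  shows "l x = (INF i\<in>vcar I. qhom (\<phi> i) (h i x))"
proof -
  \<comment> \<open>The restriction makes \<open>l'\<close> extensional, as membership in
    \<open>presheaves\<close> demands.\<close>
  define l' where "l' = (\<lambda>x\<in>vcar A. INF i\<in>vcar I. qhom (\<phi> i) (h i x))"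
  have "dist_from_one A l'"
    unfolding dist_from_one_def
  proof (intro ballI)
    fix x y assume xy: "x \<in> vcar A" "y \<in> vcar A"
    have "vhom A x y * l' y * \<phi> i \<le> h i x" if i: "i \<in> vcar I" for i
    proof -
      have "l' y \<le> qhom (\<phi> i) (h i y)" unfolding l'_def using xy i by (auto intro: INF_lower)
      then have "vhom A x y * (l' y * \<phi> i) \<le> vhom A x y * h i y"
        by (intro quantale_mult_left_mono) (simp add: le_qhom_iff)
      also have "\<dots> \<le> h i x"
        using h i xy unfolding presheaves_def dist_from_one_def by (auto simp: Pi_def)
      finally show ?thesis by (simp add: mult.assoc)
    qed
    then show "vhom A x y * l' y \<le> l' x"
      unfolding l'_def using xy by (auto simp: le_INF_iff le_qhom_iff)
  qed
  then have "l' \<in> vcar (presheaves A)" unfolding presheaves_def l'_def by simp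
  then have "is_limit (presheaves A) I \<phi> h l'"
    using h by (rule pointwise_limitI[OF pointwise_hom_presheaves]) (simp add: l'_def)
  from pointwise_limit_unique[OF pointwise_hom_presheaves l this x] x
  show ?thesis by (simp add: l'_def)
qed


section \<open>Strict theories with \<open>T1 = 1\<close>\<close>

locale T_one_theory =
  fixes \<T> :: "('u::set_universe, 'v::comm_quantale) top_theory"
  assumes strict: "strict_top_theory \<T>"
    and T_one: "T_one_eq_one \<T>"
begin

lemma monad: "monad_on_Set \<T>"
  and inj_vel: "inj (vel \<T>)"
  and small_Vset: "small (Vset \<T>)"
  and xi_algebra: "T_algebra \<T> (Vset \<T>) (\<lambda>t. vel \<T> (xi \<T> t))"
  using strict unfolding strict_top_theory_def by - (elim conjE, assumption)+

lemma T_pullback: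
  assumes "small P" "small A" "small B" "small C" "is_pullback P A B C p q f g"
  shows "is_weak_pullback (Tob \<T> P) (Tob \<T> A) (Tob \<T> B) (Tob \<T> C)
    (Tar \<T> P A p) (Tar \<T> P B q) (Tar \<T> A C f) (Tar \<T> B C g)"
  by (rule strict[unfolded strict_top_theory_def, THEN conjunct2, THEN conjunct2,
      THEN conjunct2, THEN conjunct1, rule_format])
    (use assms in simp)

lemma small_Tob: "small X \<Longrightarrow> small (Tob \<T> X)"
  by (rule monad[unfolded monad_on_Set_def, THEN conjunct1, rule_format])

lemma Tar_in:
  assumes "small X" "small Y" "f \<in> X \<rightarrow> Y" "t \<in> Tob \<T> X"
  shows "Tar \<T> X Y f t \<in> Tob \<T> Y"
proof -
  have "Tar \<T> X Y f \<in> Tob \<T> X \<rightarrow> Tob \<T> Y"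
    by (rule monad[unfolded monad_on_Set_def, THEN conjunct2, THEN conjunct1, rule_format])
      (use assms in simp)
  then show ?thesis using assms(4) by auto
qed

lemma Tar_cong:
  assumes "small X" "small Y" "f \<in> X \<rightarrow> Y" "\<And>x. x \<in> X \<Longrightarrow> f x = g x" "t \<in> Tob \<T> X"
  shows "Tar \<T> X Y f t = Tar \<T> X Y g t"
  by (rule monad[unfolded monad_on_Set_def, THEN conjunct2, THEN conjunct2, THEN conjunct1,
      rule_format])
    (use assms in simp_all)

lemma Tar_id: "small X \<Longrightarrow> t \<in> Tob \<T> X \<Longrightarrow> Tar \<T> X X (\<lambda>x. x) t = t"
  by (rule monad[unfolded monad_on_Set_def, THEN conjunct2, THEN conjunct2, THEN conjunct2,
      THEN conjunct1, rule_format])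

lemma Tar_comp:
  assumes "small X" "small Y" "small Z" "f \<in> X \<rightarrow> Y" "g \<in> Y \<rightarrow> Z" "t \<in> Tob \<T> X"
  shows "Tar \<T> Y Z g (Tar \<T> X Y f t) = Tar \<T> X Z (\<lambda>x. g (f x)) t"
  by (rule monad[unfolded monad_on_Set_def, THEN conjunct2, THEN conjunct2, THEN conjunct2,
      THEN conjunct2, THEN conjunct1, rule_format, symmetric])
    (use assms in simp_all)

lemma Tunit_in: "small X \<Longrightarrow> x \<in> X \<Longrightarrow> Tunit \<T> X x \<in> Tob \<T> X"
  using monad[unfolded monad_on_Set_def, THEN conjunct2, THEN conjunct2, THEN conjunct2,
      THEN conjunct2, THEN conjunct2, THEN conjunct1, rule_format] by blast

lemma Tunit_natural:
  assumes "small X" "small Y" "f \<in> X \<rightarrow> Y" "x \<in> X"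
  shows "Tar \<T> X Y f (Tunit \<T> X x) = Tunit \<T> Y (f x)"
  by (rule monad[unfolded monad_on_Set_def, THEN conjunct2, THEN conjunct2, THEN conjunct2,
      THEN conjunct2, THEN conjunct2, THEN conjunct2, THEN conjunct2, THEN conjunct1,
      rule_format])
    (use assms in simp_all)

lemma Tmult_Tunit: "small X \<Longrightarrow> t \<in> Tob \<T> X \<Longrightarrow> Tmult \<T> X (Tunit \<T> (Tob \<T> X) t) = t"
  by (rule monad[unfolded monad_on_Set_def, THEN conjunct2, THEN conjunct2, THEN conjunct2,
      THEN conjunct2, THEN conjunct2, THEN conjunct2, THEN conjunct2, THEN conjunct2,
      THEN conjunct2, THEN conjunct1, rule_format])

text \<open>This is where T1 = 1 enters: a constant map factors through \<open>{y}\<close>, and T of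
  that set has a single element, which must be the unit.\<close>

lemma Tar_const:
  assumes "small X" "small Y" "y \<in> Y" "t \<in> Tob \<T> X"
  shows "Tar \<T> X Y (\<lambda>_. y) t = Tunit \<T> Y y"
proof -
  obtain q where q: "Tob \<T> {y} = {q}" using T_one unfolding T_one_eq_one_def by blast
  have "Tar \<T> X {y} (\<lambda>_. y) t \<in> Tob \<T> {y}" "Tunit \<T> {y} y \<in> Tob \<T> {y}"
    using assms by (auto intro!: Tar_in Tunit_in small_singleton)
  then have "Tar \<T> X {y} (\<lambda>_. y) t = Tunit \<T> {y} y" unfolding q by simp
  then have "Tar \<T> {y} Y (\<lambda>z. z) (Tar \<T> X {y} (\<lambda>_. y) t) = Tunit \<T> Y y"
    using Tunit_natural[OF small_singleton assms(2), of "\<lambda>z. z" y y] assms(3) by simp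
  then show ?thesis using Tar_comp[of X "{y}" Y "\<lambda>_. y" "\<lambda>z. z" t] assms small_singleton[of y]
    by simp
qed

section \<open>Coding of V, and rules for computing with \<open>xi_ext\<close>\<close>

lemma val_vel [simp]: "val \<T> (vel \<T> v) = v"
  unfolding val_def by (simp add: inj_vel)

lemma vel_in_Vset [simp]: "vel \<T> v \<in> Vset \<T>"
  unfolding Vset_def by simp

lemma vel_val: "y \<in> Vset \<T> \<Longrightarrow> vel \<T> (val \<T> y) = y"
  unfolding Vset_def by auto

lemma xi_ext_comp:
  assumes "small X" "small Y" "f \<in> X \<rightarrow> Y" "t \<in> Tob \<T> X"
  shows "xi_ext \<T> Y \<phi> (Tar \<T> X Y f t) = xi_ext \<T> X (\<lambda>x. \<phi> (f x)) t"
  unfolding xi_ext_def using Tar_comp[OF assms(1,2) small_Vset assms(3) _ assms(4)] by simp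

lemma xi_ext_cong:
  assumes "small X" "\<And>x. x \<in> X \<Longrightarrow> \<phi> x = \<psi> x" "t \<in> Tob \<T> X"
  shows "xi_ext \<T> X \<phi> t = xi_ext \<T> X \<psi> t"
proof -
  have "Tar \<T> X (Vset \<T>) (\<lambda>x. vel \<T> (\<phi> x)) t = Tar \<T> X (Vset \<T>) (\<lambda>x. vel \<T> (\<psi> x)) t"
    by (rule Tar_cong[OF assms(1) small_Vset]) (use assms in auto)
  then show ?thesis unfolding xi_ext_def by simp
qed

lemma xi_ext_mono:
  assumes "small X" "\<And>x. x \<in> X \<Longrightarrow> \<phi> x \<le> \<psi> x" "t \<in> Tob \<T> X"
  shows "xi_ext \<T> X \<phi> t \<le> xi_ext \<T> X \<psi> t"
  by (rule strict[unfolded strict_top_theory_def, THEN conjunct2, THEN conjunct2,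
      THEN conjunct2, THEN conjunct2, THEN conjunct2, THEN conjunct2, THEN conjunct2,
      THEN conjunct2, THEN conjunct1, rule_format])
    (use assms in simp_all)

lemma xi_ext_PV:
  assumes "small X" "small Y" "f \<in> X \<rightarrow> Y" "t \<in> Tob \<T> Y"
  shows "xi_ext \<T> Y (PV X f \<phi>) t = PV (Tob \<T> X) (Tar \<T> X Y f) (xi_ext \<T> X \<phi>) t"
  by (rule strict[unfolded strict_top_theory_def, THEN conjunct2, THEN conjunct2,
      THEN conjunct2, THEN conjunct2, THEN conjunct2, THEN conjunct2, THEN conjunct2,
      THEN conjunct2, THEN conjunct2, rule_format])
    (use assms in simp_all)

lemma xi_Tunit: "xi \<T> (Tunit \<T> (Vset \<T>) (vel \<T> v)) = v"
proof -
  have "vel \<T> (xi \<T> (Tunit \<T> (Vset \<T>) (vel \<T> v))) = vel \<T> v"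
    using xi_algebra unfolding T_algebra_def by simp
  then show ?thesis using inj_vel by (simp add: inj_eq)
qed

lemma xi_ext_Tunit:
  assumes "small X" "x \<in> X"
  shows "xi_ext \<T> X \<phi> (Tunit \<T> X x) = \<phi> x"
  unfolding xi_ext_def
  using Tunit_natural[OF assms(1) small_Vset _ assms(2), of "\<lambda>x. vel \<T> (\<phi> x)"] xi_Tunit by simp

text \<open>By T1 = 1 the constant map sends \<open>t\<close> to the unit at \<open>v\<close>, which
  the algebra structure \<open>xi\<close> sends back to \<open>v\<close>.\<close>

lemma xi_ext_const:
  assumes "small X" "t \<in> Tob \<T> X"
  shows "xi_ext \<T> X (\<lambda>_. v) t = v"
  unfolding xi_ext_def using Tar_const[OF assms(1) small_Vset _ assms(2)] xi_Tunit by simp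

text \<open>The axiom on the tensor concerns the generic case of two projections from V x V. It is
  pulled back along the map pairing \<open>\<phi>\<close> with \<open>\<psi>\<close>.\<close>

lemma xi_ext_mult:
  assumes "small X" "t \<in> Tob \<T> X"
  shows "xi_ext \<T> X (\<lambda>x. \<phi> x * \<psi> x) t = xi_ext \<T> X \<phi> t * xi_ext \<T> X \<psi> t"
proof -
  let ?V = "Vset \<T>" and ?f = "\<lambda>x. pair (vel \<T> (\<phi> x)) (vel \<T> (\<psi> x))"
  define w where "w = Tar \<T> X (?V \<boxtimes> ?V) ?f t"
  have sm: "small (?V \<boxtimes> ?V)" by (intro small_prodset small_Vset)
  have f: "?f \<in> X \<rightarrow> ?V \<boxtimes> ?V" by simp
  have pr: "pfst \<in> ?V \<boxtimes> ?V \<rightarrow> ?V" "psnd \<in> ?V \<boxtimes> ?V \<rightarrow> ?V" by (auto elim: prodsetE)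
  have w: "w \<in> Tob \<T> (?V \<boxtimes> ?V)" unfolding w_def by (rule Tar_in[OF assms(1) sm f assms(2)])
  have "xi_ext \<T> (?V \<boxtimes> ?V) (\<lambda>p. val \<T> (pfst p) * val \<T> (psnd p)) w =
    xi \<T> (Tar \<T> (?V \<boxtimes> ?V) ?V pfst w) * xi \<T> (Tar \<T> (?V \<boxtimes> ?V) ?V psnd w)"
    by (rule strict[unfolded strict_top_theory_def, THEN conjunct2, THEN conjunct2,
      THEN conjunct2, THEN conjunct2, THEN conjunct2, THEN conjunct2, THEN conjunct1,
      rule_format, OF w])
  then show ?thesis
    unfolding w_def xi_ext_comp[OF assms(1) sm f assms(2)]
      Tar_comp[OF assms(1) sm small_Vset f pr(1) assms(2)]
      Tar_comp[OF assms(1) sm small_Vset f pr(2) assms(2)]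
    by (simp add: xi_ext_def)
qed


section \<open>Functors into the quantale\<close>

text \<open>This is the condition for a T-functor from \<open>X\<close> to V with
  \<open>qhom\<close> rewritten as a product. Values are taken in the type \<open>'v\<close>, which
  keeps codes out of the calculations.\<close>

definition T_functional :: "('u, 'v) tgraph \<Rightarrow> ('u \<Rightarrow> 'v) \<Rightarrow> bool" where
  "T_functional X \<phi> \<longleftrightarrow>
     (\<forall>t\<in>Tob \<T> (tcar X). \<forall>x\<in>tcar X. tstr X t x * xi_ext \<T> (tcar X) \<phi> t \<le> \<phi> x)"

definition encode :: "('u, 'v) tgraph \<Rightarrow> ('u \<Rightarrow> 'v) \<Rightarrow> 'u" where
  "encode X \<phi> = fun_code (tcar X) (\<lambda>x. vel \<T> (\<phi> x))"

lemma T_categoryD: "T_category \<T> X \<Longrightarrow> small (tcar X)"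
  unfolding T_category_def T_graph_def by blast

lemma ap_encode [simp]: "small (tcar X) \<Longrightarrow> x \<in> tcar X \<Longrightarrow> ap \<T> (encode X \<phi>) x = \<phi> x"
  unfolding ap_def encode_def by (simp add: fun_app_fun_code)

lemma T_functional_cong:
  assumes "small (tcar X)" "\<And>x. x \<in> tcar X \<Longrightarrow> \<phi> x = \<psi> x"
  shows "T_functional X \<phi> \<longleftrightarrow> T_functional X \<psi>"
  unfolding T_functional_def using assms xi_ext_cong[OF assms] by simp

text \<open>On the carrier, decoding and recoding the values of \<open>f\<close> changes nothing, so
  neither the graph of \<open>f\<close> nor the action of T on it is affected.\<close>

lemma Vpow_set_eq:
  assumes X: "small (tcar X)"
  shows "Vpow_set \<T> X = {encode X \<phi> | \<phi>. T_functional X \<phi>}"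
proof -
  have iff: "T_morphism \<T> X (V_graph \<T>) (\<lambda>x. vel \<T> (\<phi> x)) \<longleftrightarrow> T_functional X \<phi>" for \<phi>
    unfolding T_morphism_def V_graph_def T_functional_def xi_ext_def by (simp add: le_qhom_iff)
  have "\<exists>\<phi>. fun_code (tcar X) f = encode X \<phi> \<and> T_functional X \<phi>"
    if f: "T_morphism \<T> X (V_graph \<T>) f" for f
  proof (intro exI conjI)
    have V: "f \<in> tcar X \<rightarrow> Vset \<T>" using f unfolding T_morphism_def V_graph_def by simp
    then have fx: "vel \<T> (val \<T> (f x)) = f x" if "x \<in> tcar X" for x
      using that by (auto intro: vel_val)
    show "fun_code (tcar X) f = encode X (\<lambda>x. val \<T> (f x))"
      unfolding encode_def by (rule fun_code_cong) (simp add: fx)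
    have "Tar \<T> (tcar X) (Vset \<T>) f t = Tar \<T> (tcar X) (Vset \<T>) (\<lambda>x. vel \<T> (val \<T> (f x))) t"
      if "t \<in> Tob \<T> (tcar X)" for t
      by (rule Tar_cong[OF X small_Vset V _ that]) (simp add: fx)
    then show "T_functional X (\<lambda>x. val \<T> (f x))"
      using f unfolding T_morphism_def V_graph_def T_functional_def xi_ext_def
      by (simp add: le_qhom_iff)
  qed
  then show ?thesis unfolding Vpow_set_def using iff unfolding encode_def by blast
qed

lemma encode_in: "small (tcar X) \<Longrightarrow> T_functional X \<phi> \<Longrightarrow> encode X \<phi> \<in> Vpow_set \<T> X"
  by (auto simp: Vpow_set_eq)

lemma T_functional_ap:
  "small (tcar X) \<Longrightarrow> p \<in> Vpow_set \<T> X \<Longrightarrow> T_functional X (ap \<T> p)"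
  by (auto simp: Vpow_set_eq intro: T_functional_cong[THEN iffD2, OF _ ap_encode])

lemma vel_ap:
  "small (tcar X) \<Longrightarrow> p \<in> Vpow_set \<T> X \<Longrightarrow> x \<in> tcar X \<Longrightarrow> vel \<T> (ap \<T> p x) = fun_app p x"
  by (auto simp: Vpow_set_eq) (simp add: encode_def fun_app_fun_code)

lemma Vpow_set_eqI:
  assumes X: "small (tcar X)" and "p \<in> Vpow_set \<T> X" "q \<in> Vpow_set \<T> X"
    and "\<And>x. x \<in> tcar X \<Longrightarrow> ap \<T> p x = ap \<T> q x"
  shows "p = q"
proof -
  obtain \<phi> \<psi> where "p = encode X \<phi>" "q = encode X \<psi>"
    using assms(2,3) by (auto simp: Vpow_set_eq[OF X])
  moreover from this have "\<phi> x = \<psi> x" if "x \<in> tcar X" for x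
    using assms(4)[OF that] that X by simp
  ultimately show ?thesis by (auto simp: encode_def intro!: fun_code_cong)
qed

text \<open>Each element codes a graph contained in X x V, so the power set axiom bounds them
  all.\<close>

lemma small_Vpow_set:
  assumes X: "small (tcar X)"
  shows "small (Vpow_set \<T> X)"
proof -
  have "Vpow_set \<T> X \<subseteq> {y. elts y \<subseteq> tcar X \<boxtimes> Vset \<T>}"
    by (auto simp: Vpow_set_eq[OF X] encode_def elts_fun_code[OF X])
  then show ?thesis
    using small_subset small_Pow small_prodset X small_Vset by metis
qed

section \<open>Operations on T-functors into V, and the representable ones\<close>

lemma T_functional_le:
  "T_functional X \<phi> \<Longrightarrow> t \<in> Tob \<T> (tcar X) \<Longrightarrow> x \<in> tcar X \<Longrightarrow>
    tstr X t x * xi_ext \<T> (tcar X) \<phi> t \<le> \<phi> x"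
  unfolding T_functional_def by blast

text \<open>Multiplication by \<open>v\<close> commutes with \<open>xi_ext\<close>, which preserves
  products and constants.\<close>

lemma T_functional_mult:
  assumes X: "small (tcar X)" and "T_functional X \<phi>"
  shows "T_functional X (\<lambda>x. v * \<phi> x)"
  unfolding T_functional_def
proof (intro ballI)
  fix t x assume t: "t \<in> Tob \<T> (tcar X)" and x: "x \<in> tcar X"
  have "v * (tstr X t x * xi_ext \<T> (tcar X) \<phi> t) \<le> v * \<phi> x"
    by (rule quantale_mult_left_mono[OF T_functional_le[OF assms(2) t x]])
  then show "tstr X t x * xi_ext \<T> (tcar X) (\<lambda>x. v * \<phi> x) t \<le> v * \<phi> x"
    by (simp add: xi_ext_mult[OF X t] xi_ext_const[OF X t] mult.left_commute)
qed

text \<open>The constant \<open>\<phi> i\<close> can be moved inside \<open>xi_ext\<close>;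
  monotonicity then bounds the product by \<open>xi_ext\<close> of \<open>g i\<close>, for each
  index separately.\<close>

lemma T_functional_INF:
  assumes X: "small (tcar X)" and g: "\<And>i. i \<in> I \<Longrightarrow> T_functional X (g i)"
  shows "T_functional X (\<lambda>x. INF i\<in>I. qhom (\<phi> i) (g i x))"
  unfolding T_functional_def
proof (intro ballI)
  fix t x assume t: "t \<in> Tob \<T> (tcar X)" and x: "x \<in> tcar X"
  let ?l = "\<lambda>x. INF i\<in>I. qhom (\<phi> i) (g i x)"
  have "tstr X t x * xi_ext \<T> (tcar X) ?l t * \<phi> i \<le> g i x" if i: "i \<in> I" for i
  proof -
    have "xi_ext \<T> (tcar X) ?l t * \<phi> i = xi_ext \<T> (tcar X) (\<lambda>x. ?l x * \<phi> i) t"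
      by (simp add: xi_ext_mult[OF X t] xi_ext_const[OF X t])
    also have "\<dots> \<le> xi_ext \<T> (tcar X) (g i) t"
    proof (rule xi_ext_mono[OF X _ t])
      fix y
      have "?l y \<le> qhom (\<phi> i) (g i y)" using i by (rule INF_lower)
      then show "?l y * \<phi> i \<le> g i y" by (simp add: le_qhom_iff)
    qed
    finally have "tstr X t x * (xi_ext \<T> (tcar X) ?l t * \<phi> i) \<le> tstr X t x * xi_ext \<T> (tcar X) (g i) t"
      by (rule quantale_mult_left_mono)
    also have "\<dots> \<le> g i x" by (rule T_functional_le[OF g[OF i] t x])
    finally show ?thesis by (simp add: mult.assoc)
  qed
  then show "tstr X t x * xi_ext \<T> (tcar X) ?l t \<le> ?l x" by (simp add: le_INF_iff le_qhom_iff)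
qed

text \<open>The category axiom is used at the doubled unit e(e(x)) in TTX and at \<open>t\<close>;
  multiplication takes the doubled unit back to e(x).\<close>

lemma T_functional_representable:
  assumes X: "T_category \<T> X" and x: "x \<in> tcar X"
  shows "T_functional X (tstr X (Tunit \<T> (tcar X) x))"
  unfolding T_functional_def
proof (intro ballI)
  fix t y assume t: "t \<in> Tob \<T> (tcar X)" and y: "y \<in> tcar X"
  note sX = T_categoryD[OF X]
  note sTX = small_Tob[OF sX]
  let ?e = "Tunit \<T> (tcar X) x" and ?TX = "Tob \<T> (tcar X)"
  let ?D = "?TX \<boxtimes> tcar X"
  have e: "?e \<in> ?TX" by (rule Tunit_in[OF sX x])
  have sD: "small ?D" by (intro small_prodset sX sTX)
  have f: "pair ?e \<in> tcar X \<rightarrow> ?D" using e by simp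
  \<comment> \<open>\<open>w\<close> is the witness in the supremum defining \<open>T_xi\<close>: it
    pairs \<open>t\<close> with the constant \<open>?e\<close>. By \<open>Tar_const\<close> its
    first projection is the doubled unit.\<close>
  define w where "w = Tar \<T> (tcar X) ?D (pair ?e) t"
  have w: "w \<in> Tob \<T> ?D" unfolding w_def by (rule Tar_in[OF sX sD f t])
  have pr: "pfst \<in> ?D \<rightarrow> ?TX" "psnd \<in> ?D \<rightarrow> tcar X" by (auto elim: prodsetE)
  have 1: "Tar \<T> ?D ?TX pfst w = Tunit \<T> ?TX ?e"
    unfolding w_def Tar_comp[OF sX sD sTX f pr(1) t] by (simp add: Tar_const[OF sX sTX e t])
  have 2: "Tar \<T> ?D (tcar X) psnd w = t"
    unfolding w_def Tar_comp[OF sX sD sX f pr(2) t] by (simp add: Tar_id[OF sX t])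
  have 3: "xi_ext \<T> ?D (\<lambda>p. tstr X (pfst p) (psnd p)) w = xi_ext \<T> (tcar X) (tstr X ?e) t"
    unfolding w_def xi_ext_comp[OF sX sD f t] by simp
  have "xi_ext \<T> (tcar X) (tstr X ?e) t \<le> T_xi \<T> (tcar X) ?TX (tstr X) (Tunit \<T> ?TX ?e) t"
    unfolding T_xi_def 3[symmetric] by (rule Sup_upper) (use w 1 2 in blast)
  then have "tstr X t y * xi_ext \<T> (tcar X) (tstr X ?e) t
      \<le> tstr X t y * T_xi \<T> (tcar X) ?TX (tstr X) (Tunit \<T> ?TX ?e) t"
    by (rule quantale_mult_left_mono)
  also have "\<dots> \<le> tstr X (Tmult \<T> (tcar X) (Tunit \<T> ?TX ?e)) y"
    using X t y Tunit_in[OF sTX e] unfolding T_category_def by (simp add: mult.commute)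
  also have "\<dots> = tstr X ?e y" by (simp add: Tmult_Tunit[OF sX e])
  finally show "tstr X t y * xi_ext \<T> (tcar X) (tstr X ?e) t \<le> tstr X ?e y" .
qed


section \<open>The graph structure of the function spaces\<close>

lemma pointwise_hom_Vpow: "pointwise_hom (Vpow_vcat \<T> X) (tcar X) (ap \<T>)"
  unfolding pointwise_hom_def Vpow_vcat_def by simp

lemma vcar_Vpow [simp]: "vcar (Vpow_vcat \<T> X) = Vpow_set \<T> X"
  unfolding Vpow_vcat_def by simp

lemma tcar_Vpow [simp]: "tcar (Vpow_tgraph \<T> X) = Vpow_set \<T> X"
  unfolding Vpow_tgraph_def by simp

text \<open>The nested homs are uncurried. Instances with \<open>u\<close> equal to \<open>1\<close>
  or to the structure value itself serve later to extract inequalities.\<close>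

lemma le_tstr_Vpow_iff:
  "u \<le> tstr (Vpow_tgraph \<T> X) p \<phi> \<longleftrightarrow>
    (\<forall>x\<in>tcar X. \<forall>q\<in>Tob \<T> (tcar X \<boxtimes> Vpow_set \<T> X).
      Tar \<T> (tcar X \<boxtimes> Vpow_set \<T> X) (Vpow_set \<T> X) psnd q = p \<longrightarrow>
      u * (tstr X (Tar \<T> (tcar X \<boxtimes> Vpow_set \<T> X) (tcar X) pfst q) x
        * xi_ext \<T> (tcar X \<boxtimes> Vpow_set \<T> X) (\<lambda>p. ap \<T> (psnd p) (pfst p)) q) \<le> ap \<T> \<phi> x)"
  unfolding Vpow_tgraph_def by (simp add: Let_def le_Inf_Collect_iff le_qhom_iff mult.assoc) blast

text \<open>The fibre of \<open>psnd\<close> over \<open>w\<close> is a copy of \<open>X\<close>,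
  namely the pullback along the inclusion of \<open>{w}\<close>. Its image under T is a weak
  pullback, which allows \<open>q\<close> to be lifted.\<close>

lemma T_fibre:
  assumes X: "small X" and W: "small W" "w \<in> W" and q: "q \<in> Tob \<T> (X \<boxtimes> W)"
    and eq: "Tar \<T> (X \<boxtimes> W) W psnd q = Tunit \<T> W w"
  obtains t where "t \<in> Tob \<T> X" "q = Tar \<T> X (X \<boxtimes> W) (\<lambda>x. pair x w) t"
proof -
  have "is_pullback X (X \<boxtimes> W) {w} W (\<lambda>x. pair x w) (\<lambda>_. w) psnd (\<lambda>z. z)"
    by (rule is_pullbackI) (use W in \<open>auto elim!: prodsetE simp: pair_eq_iff\<close>)
  from T_pullback[OF X small_prodset[OF X W(1)] small_singleton W(1) this]
  have wp: "is_weak_pullback (Tob \<T> X) (Tob \<T> (X \<boxtimes> W)) (Tob \<T> {w}) (Tob \<T> W)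
    (Tar \<T> X (X \<boxtimes> W) (\<lambda>x. pair x w)) (Tar \<T> X {w} (\<lambda>_. w))
    (Tar \<T> (X \<boxtimes> W) W psnd) (Tar \<T> {w} W (\<lambda>z. z))" .
  have "Tar \<T> {w} W (\<lambda>z. z) (Tunit \<T> {w} w) = Tunit \<T> W w"
    using Tunit_natural[OF small_singleton W(1), of "\<lambda>z. z" w w] W(2) by simp
  then show ?thesis
    using weak_pullbackE[OF wp q Tunit_in[OF small_singleton, of w w]] eq that by auto
qed

text \<open>By \<open>T_fibre\<close>, the elements over the unit at \<open>\<phi>\<close> come from
  elements \<open>t\<close> of TX, and evaluation along them is \<open>xi_ext\<close> of
  \<open>\<phi>\<close> at \<open>t\<close>. The result identifies the underlying V-graph.\<close>

lemma tstr_Vpow_Tunit: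
  assumes X: "small (tcar X)" and T1: "T_graph \<T> X"
    and \<phi>: "\<phi> \<in> Vpow_set \<T> X" and \<psi>: "\<psi> \<in> Vpow_set \<T> X"
  shows "tstr (Vpow_tgraph \<T> X) (Tunit \<T> (Vpow_set \<T> X) \<phi>) \<psi>
    = (INF x\<in>tcar X. qhom (ap \<T> \<phi> x) (ap \<T> \<psi> x))" (is "?L = ?R")
proof (rule order_eqI)
  fix u
  let ?W = "Vpow_set \<T> X"
  let ?D = "tcar X \<boxtimes> ?W" and ?f = "\<lambda>x. pair x \<phi>"
  note W = small_Vpow_set[OF X]
  have D: "small ?D" by (intro small_prodset X W)
  have f: "?f \<in> tcar X \<rightarrow> ?D" using \<phi> by simp
  have pr: "pfst \<in> ?D \<rightarrow> tcar X" "psnd \<in> ?D \<rightarrow> ?W" by (auto elim: prodsetE)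
  have q: "Tar \<T> ?D (tcar X) pfst (Tar \<T> (tcar X) ?D ?f t) = t"
      "Tar \<T> ?D ?W psnd (Tar \<T> (tcar X) ?D ?f t) = Tunit \<T> ?W \<phi>"
      "xi_ext \<T> ?D (\<lambda>p. ap \<T> (psnd p) (pfst p)) (Tar \<T> (tcar X) ?D ?f t)
        = xi_ext \<T> (tcar X) (ap \<T> \<phi>) t"
    if t: "t \<in> Tob \<T> (tcar X)" for t
    using Tar_comp[OF X D X f pr(1) t] Tar_comp[OF X D W f pr(2) t] xi_ext_comp[OF X D f t]
      Tar_id[OF X t] Tar_const[OF X W \<phi> t] by simp_all
  have "u \<le> ?L \<longleftrightarrow> (\<forall>x\<in>tcar X. \<forall>t\<in>Tob \<T> (tcar X).
      u * (tstr X t x * xi_ext \<T> (tcar X) (ap \<T> \<phi>) t) \<le> ap \<T> \<psi> x)" (is "_ \<longleftrightarrow> ?M")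
    unfolding le_tstr_Vpow_iff
  proof (rule ball_cong[OF refl], intro iffI ballI impI)
    fix x t assume "\<forall>q\<in>Tob \<T> ?D. Tar \<T> ?D ?W psnd q = Tunit \<T> ?W \<phi> \<longrightarrow>
        u * (tstr X (Tar \<T> ?D (tcar X) pfst q) x
          * xi_ext \<T> ?D (\<lambda>p. ap \<T> (psnd p) (pfst p)) q) \<le> ap \<T> \<psi> x"
      and t: "t \<in> Tob \<T> (tcar X)"
    from this(1)[THEN bspec, OF Tar_in[OF X D f t]]
    show "u * (tstr X t x * xi_ext \<T> (tcar X) (ap \<T> \<phi>) t) \<le> ap \<T> \<psi> x"
      by (simp only: q[OF t])
  next
    fix x r
    assume *: "\<forall>t\<in>Tob \<T> (tcar X). u * (tstr X t x * xi_ext \<T> (tcar X) (ap \<T> \<phi>) t) \<le> ap \<T> \<psi> x"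
      and r: "r \<in> Tob \<T> ?D" "Tar \<T> ?D ?W psnd r = Tunit \<T> ?W \<phi>"
    obtain t where t: "t \<in> Tob \<T> (tcar X)" "r = Tar \<T> (tcar X) ?D ?f t"
      using T_fibre[OF X W \<phi> r] .
    show "u * (tstr X (Tar \<T> ?D (tcar X) pfst r) x
          * xi_ext \<T> ?D (\<lambda>p. ap \<T> (psnd p) (pfst p)) r) \<le> ap \<T> \<psi> x"
      using * t(1) by (simp only: t(2) q[OF t(1)])
  qed
  \<comment> \<open>One direction takes \<open>t\<close> to be the unit at \<open>x\<close> and uses
    reflexivity of \<open>X\<close>; the other uses that \<open>\<phi>\<close> is a
    T-functor.\<close>
  also have "?M \<longleftrightarrow> (\<forall>x\<in>tcar X. u * ap \<T> \<phi> x \<le> ap \<T> \<psi> x)"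
  proof (intro ball_cong refl iffI ballI)
    fix x assume x: "x \<in> tcar X"
      and *: "\<forall>t\<in>Tob \<T> (tcar X). u * (tstr X t x * xi_ext \<T> (tcar X) (ap \<T> \<phi>) t) \<le> ap \<T> \<psi> x"
    have "1 * ap \<T> \<phi> x \<le> tstr X (Tunit \<T> (tcar X) x) x * ap \<T> \<phi> x"
      using T1 x unfolding T_graph_def by (intro quantale_mult_mono) auto
    then have "u * ap \<T> \<phi> x \<le> u * (tstr X (Tunit \<T> (tcar X) x) x * ap \<T> \<phi> x)"
      by (intro quantale_mult_left_mono) simp
    also have "\<dots> \<le> ap \<T> \<psi> x"
      using *[THEN bspec, OF Tunit_in[OF X x]] xi_ext_Tunit[OF X x] by simp
    finally show "u * ap \<T> \<phi> x \<le> ap \<T> \<psi> x" .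
  next
    fix x t assume x: "x \<in> tcar X" and *: "u * ap \<T> \<phi> x \<le> ap \<T> \<psi> x"
      and t: "t \<in> Tob \<T> (tcar X)"
    have "u * (tstr X t x * xi_ext \<T> (tcar X) (ap \<T> \<phi>) t) \<le> u * ap \<T> \<phi> x"
      by (intro quantale_mult_left_mono T_functional_le[OF T_functional_ap[OF X \<phi>] t x])
    then show "u * (tstr X t x * xi_ext \<T> (tcar X) (ap \<T> \<phi>) t) \<le> ap \<T> \<psi> x" using * by simp
  qed
  also have "\<dots> \<longleftrightarrow> u \<le> ?R" by (simp add: le_INF_iff le_qhom_iff)
  finally show "u \<le> ?L \<longleftrightarrow> u \<le> ?R" .
qed

lemma T_category_T_graph: "T_category \<T> X \<Longrightarrow> T_graph \<T> X"
  unfolding T_category_def by blast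

lemma underlying_Vpow:
  assumes X: "T_category \<T> X"
  shows "underlying \<T> (Vpow_tgraph \<T> X) = Vpow_vcat \<T> X"
  unfolding underlying_def Vpow_vcat_def tcar_Vpow
  using tstr_Vpow_Tunit[OF T_categoryD[OF X] T_category_T_graph[OF X]]
  by (auto simp: fun_eq_iff restrict_def)

lemma T_graph_Vpow:
  assumes X: "T_category \<T> X"
  shows "T_graph \<T> (Vpow_tgraph \<T> X)"
  unfolding T_graph_def tcar_Vpow
  using tstr_Vpow_Tunit[OF T_categoryD[OF X] T_category_T_graph[OF X]]
    small_Vpow_set[OF T_categoryD[OF X]]
  by (simp add: le_INF_iff one_le_qhom_iff)

lemma Vpow_small_v_category:
  assumes X: "T_category \<T> X"
  shows "small_v_category (Vpow_vcat \<T> X)"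
  unfolding small_v_category_def
  using small_Vpow_set[OF T_categoryD[OF X]] pointwise_v_category[OF pointwise_hom_Vpow] by simp

section \<open>Limits, colimits and tensors in \<open>V^X\<close>\<close>

lemma Vpow_limit:
  assumes X: "T_category \<T> X" and h: "h \<in> vcar I \<rightarrow> Vpow_set \<T> X"
  shows "is_limit (Vpow_vcat \<T> X) I \<phi> h
    (encode X (\<lambda>x. INF i\<in>vcar I. qhom (\<phi> i) (ap \<T> (h i) x)))"
  by (rule pointwise_limitI[OF pointwise_hom_Vpow])
    (use h T_categoryD[OF X] in \<open>auto intro!: encode_in T_functional_INF T_functional_ap\<close>)

lemma ap_limit:
  assumes X: "T_category \<T> X" and h: "h \<in> vcar I \<rightarrow> Vpow_set \<T> X"
    and l: "is_limit (Vpow_vcat \<T> X) I \<phi> h l" and x: "x \<in> tcar X"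
  shows "ap \<T> l x = (INF i\<in>vcar I. qhom (\<phi> i) (ap \<T> (h i) x))"
  using pointwise_limit_unique[OF pointwise_hom_Vpow l Vpow_limit[OF X h] x] T_categoryD[OF X] x
  by simp

lemma Vpow_v_complete:
  assumes X: "T_category \<T> X"
  shows "v_complete (Vpow_vcat \<T> X)"
  unfolding v_complete_def v_functor_def using Vpow_limit[OF X] by auto

text \<open>Unlike limits, pointwise suprema of T-functors need not be T-functors, hence the premise
  \<open>sup\<close>.\<close>

lemma ap_colimit:
  assumes X: "T_category \<T> X" and h: "h \<in> vcar I \<rightarrow> Vpow_set \<T> X"
    and sup: "T_functional X (\<lambda>x. SUP i\<in>vcar I. \<psi> i * ap \<T> (h i) x)"
    and c: "is_colimit (Vpow_vcat \<T> X) I \<psi> h c" and x: "x \<in> tcar X"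
  shows "ap \<T> c x = (SUP i\<in>vcar I. \<psi> i * ap \<T> (h i) x)"
proof -
  have "is_colimit (Vpow_vcat \<T> X) I \<psi> h (encode X (\<lambda>x. SUP i\<in>vcar I. \<psi> i * ap \<T> (h i) x))"
    by (rule pointwise_colimitI[OF pointwise_hom_Vpow])
      (use h sup T_categoryD[OF X] in \<open>auto intro!: encode_in\<close>)
  from pointwise_colimit_unique[OF pointwise_hom_Vpow c this x] T_categoryD[OF X] x
  show ?thesis by simp
qed

lemma ap_tensor:
  assumes X: "T_category \<T> X" and \<phi>: "\<phi> \<in> Vpow_set \<T> X"
    and t: "is_tensor (Vpow_vcat \<T> X) v \<phi> t" and x: "x \<in> tcar X"
  shows "ap \<T> t x = v * ap \<T> \<phi> x"
proof -
  \<comment> \<open>A tensor is a colimit over one object; \<open>\<phi>\<close> itself serves as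
    that object.\<close>
  let ?I = "\<lparr>vcar = {\<phi>}, vhom = \<lambda>_ _. 1\<rparr> :: ('u, 'v) vgraph"
  have "T_functional X (\<lambda>x. SUP i\<in>vcar ?I. v * ap \<T> \<phi> x)"
    using T_functional_mult[OF T_categoryD[OF X] T_functional_ap[OF T_categoryD[OF X] \<phi>]] by simp
  from ap_colimit[OF X _ this _ x, of t] t \<phi>
  show ?thesis by (simp add: is_tensor_iff_colimit[of ?I \<phi>])
qed

text \<open>The tensors \<open>t i\<close> absorb the weights, so the claim concerns their supremum
  \<open>s\<close>. The morphism condition on \<open>t\<close> bounds every contribution to
  \<open>s\<close> by the value of one member \<open>t (\<alpha> j)\<close>.\<close>

lemma T_functional_weighted_sup:
  assumes X: "T_category \<T> X" and d: "T_weighted_diagram \<T> (Vpow_tgraph \<T> X) I \<psi> h"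
  shows "T_functional X (\<lambda>x. SUP i\<in>vcar I. \<psi> i * ap \<T> (h i) x)"
proof -
  let ?J = "vcar I" and ?W = "Vpow_set \<T> X"
  let ?D = "tcar X \<boxtimes> ?W" and ?P = "tcar X \<boxtimes> ?J"
  note sX = T_categoryD[OF X]
  note W = small_Vpow_set[OF sX]
  have J: "small ?J" and h: "h \<in> ?J \<rightarrow> ?W"
    using d unfolding T_weighted_diagram_def small_v_category_def v_functor_def underlying_Vpow[OF X]
    by auto
  obtain \<alpha> t where \<alpha>: "\<alpha> \<in> Tob \<T> ?J \<rightarrow> ?J"
    and ten: "\<And>i. i \<in> ?J \<Longrightarrow> is_tensor (Vpow_vcat \<T> X) (\<psi> i) (h i) (t i)"
    and tm: "T_morphism \<T> (algebra_graph ?J \<alpha>) (Vpow_tgraph \<T> X) t"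
    using d unfolding T_weighted_diagram_def T_algebra_def underlying_Vpow[OF X] by blast
  have t: "t \<in> ?J \<rightarrow> ?W" using tm unfolding T_morphism_def algebra_graph_def by simp
  \<comment> \<open>The algebra structure takes the value \<open>1\<close> at \<open>j\<close> and
    \<open>\<alpha> j\<close>.\<close>
  have t1: "1 \<le> tstr (Vpow_tgraph \<T> X) (Tar \<T> ?J ?W t j) (t (\<alpha> j))" if "j \<in> Tob \<T> ?J" for j
  proof -
    have "\<alpha> j \<in> ?J" using \<alpha> that by blast
    then have "(if \<alpha> j = \<alpha> j then 1 else bot)
        \<le> tstr (Vpow_tgraph \<T> X) (Tar \<T> ?J ?W t j) (t (\<alpha> j))"
      using tm that unfolding T_morphism_def algebra_graph_def by (auto simp only: tgraph.simps tcar_Vpow)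
    then show ?thesis by simp
  qed
  have P: "small ?P" and D: "small ?D" by (intro small_prodset sX W J)+
  have pr: "pfst \<in> ?P \<rightarrow> tcar X" "psnd \<in> ?P \<rightarrow> ?J" "pfst \<in> ?D \<rightarrow> tcar X" "psnd \<in> ?D \<rightarrow> ?W"
    by (auto elim: prodsetE)
  let ?g = "\<lambda>p. pair (pfst p) (t (psnd p))"
  have g: "?g \<in> ?P \<rightarrow> ?D" using t by (auto elim!: prodsetE)
  define s where "s = (\<lambda>x. SUP i\<in>?J. ap \<T> (t i) x)"
  let ?ev = "\<lambda>p. ap \<T> (t (psnd p)) (pfst p)"
  \<comment> \<open>\<open>s\<close> is rewritten as the image of evaluation under the projection
    from X x I, the form to which naturality of \<open>xi_ext\<close> applies.\<close>
  have PV: "PV ?P pfst ?ev x = s x" if "x \<in> tcar X" for x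
  proof -
    have "{?ev p | p. p \<in> ?P \<and> pfst p = x} = (\<lambda>i. ap \<T> (t i) x) ` ?J"
    proof (intro set_eqI iffI)
      fix v assume "v \<in> (\<lambda>i. ap \<T> (t i) x) ` ?J"
      then obtain i where "i \<in> ?J" "v = ap \<T> (t i) x" by blast
      then show "v \<in> {?ev p | p. p \<in> ?P \<and> pfst p = x}"
        using that by (intro CollectI exI[of _ "pair x i"]) simp
    qed (auto elim!: prodsetE)
    then show ?thesis unfolding PV_def s_def by simp
  qed
  have "T_functional X s"
    unfolding T_functional_def
  proof (intro ballI)
    fix u x assume u: "u \<in> Tob \<T> (tcar X)" and x: "x \<in> tcar X"
    have "xi_ext \<T> (tcar X) s u = xi_ext \<T> (tcar X) (PV ?P pfst ?ev) u"
      by (rule xi_ext_cong[OF sX _ u]) (simp add: PV)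
    also have "\<dots> = Sup {xi_ext \<T> ?P ?ev q | q. q \<in> Tob \<T> ?P \<and> Tar \<T> ?P (tcar X) pfst q = u}"
      unfolding xi_ext_PV[OF P sX pr(1) u] PV_def ..
    finally have xs: "xi_ext \<T> (tcar X) s u = \<dots>" .
    have "tstr X u x * xi_ext \<T> ?P ?ev q \<le> s x"
      if q: "q \<in> Tob \<T> ?P" "Tar \<T> ?P (tcar X) pfst q = u" for q
    proof -
      \<comment> \<open>\<open>j\<close> is the index part of \<open>q\<close>, to be fed to the
        algebra; \<open>r\<close> arises from \<open>q\<close> by applying \<open>t\<close> to the
        second coordinate and lies over the image of \<open>j\<close> in T of
        \<open>V^X\<close>.\<close>
      define j where "j = Tar \<T> ?P ?J psnd q"
      define r where "r = Tar \<T> ?P ?D ?g q"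
      have j: "j \<in> Tob \<T> ?J" unfolding j_def by (rule Tar_in[OF P J pr(2) q(1)])
      have r: "r \<in> Tob \<T> ?D" unfolding r_def by (rule Tar_in[OF P D g q(1)])
      have r1: "Tar \<T> ?D (tcar X) pfst r = u"
        unfolding r_def Tar_comp[OF P D sX g pr(3) q(1)] using q(2) by simp
      have r2: "Tar \<T> ?D ?W psnd r = Tar \<T> ?J ?W t j"
        unfolding r_def j_def Tar_comp[OF P D W g pr(4) q(1)] Tar_comp[OF P J W pr(2) t q(1)]
        by simp
      have r3: "xi_ext \<T> ?D (\<lambda>p. ap \<T> (psnd p) (pfst p)) r = xi_ext \<T> ?P ?ev q"
        unfolding r_def xi_ext_comp[OF P D g q(1)] by simp
      have "1 * (tstr X u x * xi_ext \<T> ?P ?ev q) \<le> ap \<T> (t (\<alpha> j)) x"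
        using t1[OF j, unfolded le_tstr_Vpow_iff, THEN bspec, OF x, THEN bspec, OF r]
        by (simp only: r1 r2 r3)
      also have "\<dots> \<le> s x" unfolding s_def using \<alpha> j by (auto intro!: SUP_upper)
      finally show ?thesis by simp
    qed
    then show "tstr X u x * xi_ext \<T> (tcar X) s u \<le> s x"
      unfolding xs mult_Sup by (auto intro!: SUP_least)
  qed
  moreover have "s x = (SUP i\<in>?J. \<psi> i * ap \<T> (h i) x)" if "x \<in> tcar X" for x
    unfolding s_def by (rule SUP_cong) (use ap_tensor[OF X _ ten that] h in auto)
  ultimately show ?thesis by (rule T_functional_cong[OF sX, THEN iffD1, rotated])
qed


section \<open>The frame of a \<open>\<T>\<close>-category\<close>

definition representable :: "('u, 'v) tgraph \<Rightarrow> 'u \<Rightarrow> 'u" where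
  "representable X x = encode X (tstr X (Tunit \<T> (tcar X) x))"

lemma representable_in: "T_category \<T> X \<Longrightarrow> x \<in> tcar X \<Longrightarrow> representable X x \<in> Vpow_set \<T> X"
  unfolding representable_def by (intro encode_in T_functional_representable T_categoryD)

text \<open>A Yoneda argument: evaluation at \<open>x\<close> and reflexivity of \<open>X\<close>
  give one inequality; the other is the functor condition on \<open>g\<close> at the unit of
  \<open>x\<close>.\<close>

lemma vhom_representable:
  assumes X: "T_category \<T> X" and x: "x \<in> tcar X" and g: "g \<in> Vpow_set \<T> X"
  shows "vhom (Vpow_vcat \<T> X) (representable X x) g = ap \<T> g x"
proof (rule order_eqI)
  fix u
  note sX = T_categoryD[OF X]
  let ?e = "Tunit \<T> (tcar X) x"
  have "u \<le> vhom (Vpow_vcat \<T> X) (representable X x) g \<longleftrightarrow>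
      (\<forall>y\<in>tcar X. u * tstr X ?e y \<le> ap \<T> g y)"
    using pointwise_le_vhom_iff[OF pointwise_hom_Vpow, of "representable X x" X g u]
      representable_in[OF X x] g sX by (simp add: representable_def)
  also have "\<dots> \<longleftrightarrow> u \<le> ap \<T> g x"
  proof
    assume *: "\<forall>y\<in>tcar X. u * tstr X ?e y \<le> ap \<T> g y"
    have "u * 1 \<le> u * tstr X ?e x"
      using T_category_T_graph[OF X] x unfolding T_graph_def by (intro quantale_mult_left_mono) simp
    then show "u \<le> ap \<T> g x" using * x by (metis mult_1_right order_trans)
  next
    assume *: "u \<le> ap \<T> g x"
    show "\<forall>y\<in>tcar X. u * tstr X ?e y \<le> ap \<T> g y"
    proof
      fix y assume y: "y \<in> tcar X"
      have "u * tstr X ?e y \<le> tstr X ?e y * ap \<T> g x"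
        using quantale_mult_left_mono[OF *, of "tstr X ?e y"] by (simp add: mult.commute)
      also have "\<dots> \<le> ap \<T> g y"
        using T_functional_le[OF T_functional_ap[OF sX g] Tunit_in[OF sX x] y]
          xi_ext_Tunit[OF sX x] by simp
      finally show "u * tstr X ?e y \<le> ap \<T> g y" .
    qed
  qed
  finally show "u \<le> vhom (Vpow_vcat \<T> X) (representable X x) g \<longleftrightarrow> u \<le> ap \<T> g x" .
qed

text \<open>Generation makes the values of \<open>\<Phi>\<close> at representables a T-functor of
  the point. This functor is also the supremum of all \<open>f\<close> weighted by
  \<open>\<Phi> f\<close>, so \<open>s\<close> is computed pointwise.\<close>

lemma ap_sup_T_generated:
  assumes X: "T_category \<T> X" and gen: "T_generated \<T> (Vpow_tgraph \<T> X) \<Phi>"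
    and s: "is_sup (Vpow_vcat \<T> X) \<Phi> s" and x: "x \<in> tcar X"
  shows "ap \<T> s x = \<Phi> (representable X x)"
proof -
  let ?A = "Vpow_vcat \<T> X" and ?W = "Vpow_set \<T> X" and ?y = "representable X"
  note sX = T_categoryD[OF X]
  obtain I \<psi> h where d: "T_weighted_diagram \<T> (Vpow_tgraph \<T> X) I \<psi> h"
    and \<Phi>: "\<And>f. f \<in> ?W \<Longrightarrow> \<Phi> f = (SUP i\<in>vcar I. vhom ?A f (h i) * \<psi> i)"
    using gen unfolding T_generated_def underlying_Vpow[OF X] tcar_Vpow by blast
  have dist: "\<And>f g. f \<in> ?W \<Longrightarrow> g \<in> ?W \<Longrightarrow> vhom ?A f g * \<Phi> g \<le> \<Phi> f"
    using gen unfolding T_generated_def underlying_Vpow[OF X] dist_from_one_def by simp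
  have h: "\<And>i. i \<in> vcar I \<Longrightarrow> h i \<in> ?W"
    using d unfolding T_weighted_diagram_def v_functor_def underlying_Vpow[OF X] by auto
  \<comment> \<open>By Yoneda, the generating formula at a representable becomes the weighted
    supremum of the diagram.\<close>
  have gen_at: "(SUP i\<in>vcar I. \<psi> i * ap \<T> (h i) z) = \<Phi> (?y z)" if z: "z \<in> tcar X" for z
    unfolding \<Phi>[OF representable_in[OF X z]]
    by (rule SUP_cong) (simp_all add: vhom_representable[OF X z h] mult.commute)
  \<comment> \<open>The upper bound is the distributor law read through Yoneda; it is attained at
    \<open>f = ?y z\<close>, whose value at \<open>z\<close> is above \<open>1\<close>.\<close>
  have sup_at: "(SUP f\<in>?W. \<Phi> f * ap \<T> f z) = \<Phi> (?y z)" if z: "z \<in> tcar X" for z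
  proof (rule order.antisym)
    show "(SUP f\<in>?W. \<Phi> f * ap \<T> f z) \<le> \<Phi> (?y z)"
    proof (rule SUP_least)
      fix f assume f: "f \<in> ?W"
      show "\<Phi> f * ap \<T> f z \<le> \<Phi> (?y z)"
        using dist[OF representable_in[OF X z] f] vhom_representable[OF X z f]
        by (simp add: mult.commute)
    qed
    have "1 \<le> ap \<T> (?y z) z"
      unfolding representable_def using T_category_T_graph[OF X] z sX unfolding T_graph_def by simp
    then have "\<Phi> (?y z) * 1 \<le> \<Phi> (?y z) * ap \<T> (?y z) z" by (rule quantale_mult_left_mono)
    also have "\<dots> \<le> (SUP f\<in>?W. \<Phi> f * ap \<T> f z)"
      by (rule SUP_upper[OF representable_in[OF X z]])
    finally show "\<Phi> (?y z) \<le> (SUP f\<in>?W. \<Phi> f * ap \<T> f z)" by simp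
  qed
  have "T_functional X (\<lambda>z. SUP f\<in>vcar ?A. \<Phi> f * ap \<T> f z)"
    by (rule T_functional_cong[OF sX, THEN iffD2, OF _ T_functional_weighted_sup[OF X d]])
      (simp add: gen_at sup_at)
  from ap_colimit[OF X _ this s[unfolded is_sup_iff_colimit] x] sup_at[OF x]
  show ?thesis by simp
qed

lemma T_frame_Vpow:
  assumes X: "T_category \<T> X"
  shows "T_frame \<T> (Vpow_tgraph \<T> X)"
  unfolding T_frame_def underlying_Vpow[OF X]
proof (intro conjI allI impI T_graph_Vpow X Vpow_v_complete
    pointwise_v_category[OF pointwise_hom_Vpow])
  fix I :: "('u, 'v) vgraph" and \<phi> h l s c
  assume "small_v_category I \<and> dist_to_one I \<phi> \<and>
        v_functor I (presheaves (Vpow_vcat \<T> X)) h \<and>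
        (\<forall>i \<in> vcar I. T_generated \<T> (Vpow_tgraph \<T> X) (h i)) \<and>
        is_limit (presheaves (Vpow_vcat \<T> X)) I \<phi> h l \<and> T_generated \<T> (Vpow_tgraph \<T> X) l \<and>
        (\<forall>i \<in> vcar I. is_sup (Vpow_vcat \<T> X) (h i) (s i)) \<and> is_sup (Vpow_vcat \<T> X) l c"
  then have h: "h \<in> vcar I \<rightarrow> vcar (presheaves (Vpow_vcat \<T> X))"
    and hg: "\<And>i. i \<in> vcar I \<Longrightarrow> T_generated \<T> (Vpow_tgraph \<T> X) (h i)"
    and l: "is_limit (presheaves (Vpow_vcat \<T> X)) I \<phi> h l"
    and lg: "T_generated \<T> (Vpow_tgraph \<T> X) l"
    and s: "\<And>i. i \<in> vcar I \<Longrightarrow> is_sup (Vpow_vcat \<T> X) (h i) (s i)"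
    and c: "is_sup (Vpow_vcat \<T> X) l c"
    unfolding v_functor_def by blast+
  show "is_limit (Vpow_vcat \<T> X) I \<phi> s c"
  proof (rule pointwise_limitI[OF pointwise_hom_Vpow])
    show "c \<in> vcar (Vpow_vcat \<T> X)" "s \<in> vcar I \<rightarrow> vcar (Vpow_vcat \<T> X)"
      using c s unfolding is_sup_def by auto
    fix x assume x: "x \<in> tcar X"
    \<comment> \<open>Suprema at \<open>x\<close> are values of distributors at the representable of
      \<open>x\<close>, where limits of presheaves are pointwise.\<close>
    have "ap \<T> c x = l (representable X x)" by (rule ap_sup_T_generated[OF X lg c x])
    also have "\<dots> = (INF i\<in>vcar I. qhom (\<phi> i) (h i (representable X x)))"
      using presheaves_limit[OF h l] representable_in[OF X x] by simp
    also have "\<dots> = (INF i\<in>vcar I. qhom (\<phi> i) (ap \<T> (s i) x))"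
      by (rule INF_cong) (simp_all add: ap_sup_T_generated[OF X hg s x])
    finally show "ap \<T> c x = (INF i\<in>vcar I. qhom (\<phi> i) (ap \<T> (s i) x))" .
  qed
qed


section \<open>Precomposition\<close>

lemma T_morphism_in: "T_morphism \<T> X Y f \<Longrightarrow> f \<in> tcar X \<rightarrow> tcar Y"
  unfolding T_morphism_def by blast

lemma T_morphism_cong:
  assumes "small (tcar X)" "small (tcar Y)" and f: "T_morphism \<T> X Y f"
    and eq: "\<And>x. x \<in> tcar X \<Longrightarrow> f x = g x"
  shows "T_morphism \<T> X Y g"
proof -
  have "Tar \<T> (tcar X) (tcar Y) f t = Tar \<T> (tcar X) (tcar Y) g t" if "t \<in> Tob \<T> (tcar X)" for t
    by (rule Tar_cong[OF assms(1,2) T_morphism_in[OF f] eq that])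
  then show ?thesis using f eq unfolding T_morphism_def by (auto simp: Pi_def)
qed

lemma T_morphism_id: "small (tcar X) \<Longrightarrow> T_morphism \<T> X X (\<lambda>x. x)"
  unfolding T_morphism_def by (simp add: Tar_id)

lemma T_morphism_comp:
  assumes sm: "small (tcar X)" "small (tcar Y)" "small (tcar Z)"
    and f: "T_morphism \<T> X Y f" and g: "T_morphism \<T> Y Z g"
  shows "T_morphism \<T> X Z (\<lambda>x. g (f x))"
  unfolding T_morphism_def
proof (intro conjI ballI)
  show "(\<lambda>x. g (f x)) \<in> tcar X \<rightarrow> tcar Z" using f g by (auto dest!: T_morphism_in)
  fix t x assume t: "t \<in> Tob \<T> (tcar X)" and x: "x \<in> tcar X"
  have "tstr X t x \<le> tstr Y (Tar \<T> (tcar X) (tcar Y) f t) (f x)"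
    using f t x unfolding T_morphism_def by blast
  also have "\<dots> \<le> tstr Z (Tar \<T> (tcar Y) (tcar Z) g (Tar \<T> (tcar X) (tcar Y) f t)) (g (f x))"
    using g Tar_in[OF sm(1,2) T_morphism_in[OF f] t] T_morphism_in[OF f] x
    unfolding T_morphism_def by blast
  finally show "tstr X t x \<le> tstr Z (Tar \<T> (tcar X) (tcar Z) (\<lambda>x. g (f x)) t) (g (f x))"
    by (simp only: Tar_comp[OF sm T_morphism_in[OF f] T_morphism_in[OF g] t])
qed

section \<open>Precomposition with a fixed T-functor from \<open>X\<close> to
  \<open>Y\<close>\<close>

context
  fixes X Y f
  assumes X: "T_category \<T> X" and Y: "T_category \<T> Y" and f: "T_morphism \<T> X Y f"
begin

lemma Vpow_map_eq:
  assumes "\<phi> \<in> Vpow_set \<T> Y"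
  shows "Vpow_map \<T> X Y f \<phi> = encode X (\<lambda>x. ap \<T> \<phi> (f x))"
proof -
  have "fun_app \<phi> (f x) = vel \<T> (ap \<T> \<phi> (f x))" if "x \<in> tcar X" for x
    using vel_ap[OF T_categoryD[OF Y] assms, of "f x"]
      funcset_mem[OF T_morphism_in[OF f] that] by simp
  then show ?thesis
    unfolding Vpow_map_def encode_def using assms by (auto intro: fun_code_cong)
qed

lemma T_functional_precomp:
  assumes \<phi>: "T_functional Y \<phi>"
  shows "T_functional X (\<lambda>x. \<phi> (f x))"
  unfolding T_functional_def
proof (intro ballI)
  fix t x assume t: "t \<in> Tob \<T> (tcar X)" and x: "x \<in> tcar X"
  note fX = T_morphism_in[OF f]
  let ?t = "Tar \<T> (tcar X) (tcar Y) f t"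
  have "tstr X t x * xi_ext \<T> (tcar X) (\<lambda>x. \<phi> (f x)) t \<le> tstr Y ?t (f x) * xi_ext \<T> (tcar Y) \<phi> ?t"
    unfolding xi_ext_comp[OF T_categoryD[OF X] T_categoryD[OF Y] fX t]
    using f t x unfolding T_morphism_def by (intro quantale_mult_mono) auto
  also have "\<dots> \<le> \<phi> (f x)"
    using T_functional_le[OF \<phi>] Tar_in[OF T_categoryD[OF X] T_categoryD[OF Y] fX t] fX x by blast
  finally show "tstr X t x * xi_ext \<T> (tcar X) (\<lambda>x. \<phi> (f x)) t \<le> \<phi> (f x)" .
qed

lemma Vpow_map_in: "\<phi> \<in> Vpow_set \<T> Y \<Longrightarrow> Vpow_map \<T> X Y f \<phi> \<in> Vpow_set \<T> X"
  unfolding Vpow_map_eq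
  by (intro encode_in T_functional_precomp T_functional_ap T_categoryD[OF X] T_categoryD[OF Y])

lemma ap_Vpow_map:
  "\<phi> \<in> Vpow_set \<T> Y \<Longrightarrow> x \<in> tcar X \<Longrightarrow> ap \<T> (Vpow_map \<T> X Y f \<phi>) x = ap \<T> \<phi> (f x)"
  by (simp add: Vpow_map_eq T_categoryD[OF X])

lemma v_functor_Vpow_map: "v_functor (Vpow_vcat \<T> Y) (Vpow_vcat \<T> X) (Vpow_map \<T> X Y f)"
  unfolding v_functor_def
proof (intro conjI ballI)
  fix \<phi> \<psi> assume "\<phi> \<in> vcar (Vpow_vcat \<T> Y)" "\<psi> \<in> vcar (Vpow_vcat \<T> Y)"
  then have m: "\<phi> \<in> Vpow_set \<T> Y" "\<psi> \<in> Vpow_set \<T> Y" by simp_all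
  have "\<forall>y\<in>tcar Y. vhom (Vpow_vcat \<T> Y) \<phi> \<psi> * ap \<T> \<phi> y \<le> ap \<T> \<psi> y"
    using pointwise_le_vhom_iff[OF pointwise_hom_Vpow, of \<phi> Y \<psi>, THEN iffD1, OF _ _ order.refl] m
    by simp
  then show "vhom (Vpow_vcat \<T> Y) \<phi> \<psi>
      \<le> vhom (Vpow_vcat \<T> X) (Vpow_map \<T> X Y f \<phi>) (Vpow_map \<T> X Y f \<psi>)"
    using pointwise_le_vhom_iff[OF pointwise_hom_Vpow, of "Vpow_map \<T> X Y f \<phi>" X "Vpow_map \<T> X Y f \<psi>"]
      m Vpow_map_in ap_Vpow_map T_morphism_in[OF f] by (auto simp: Pi_def)
qed (use Vpow_map_in in simp)

lemma preserves_limits_Vpow_map: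
  "preserves_limits (Vpow_vcat \<T> Y) (Vpow_vcat \<T> X) (Vpow_map \<T> X Y f)"
  unfolding preserves_limits_def
proof (intro allI impI)
  fix I :: "('u, 'v) vgraph" and \<phi> h l
  assume "small_v_category I \<and> dist_to_one I \<phi> \<and> v_functor I (Vpow_vcat \<T> Y) h \<and>
    is_limit (Vpow_vcat \<T> Y) I \<phi> h l"
  then have h: "h \<in> vcar I \<rightarrow> Vpow_set \<T> Y" and l: "is_limit (Vpow_vcat \<T> Y) I \<phi> h l"
    unfolding v_functor_def by auto
  have hi: "\<And>i. i \<in> vcar I \<Longrightarrow> h i \<in> Vpow_set \<T> Y" using h by auto
  have lY: "l \<in> Vpow_set \<T> Y" using l unfolding is_limit_def by simp
  have fX: "\<And>x. x \<in> tcar X \<Longrightarrow> f x \<in> tcar Y" using T_morphism_in[OF f] by auto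
  show "is_limit (Vpow_vcat \<T> X) I \<phi> (\<lambda>i. Vpow_map \<T> X Y f (h i)) (Vpow_map \<T> X Y f l)"
    by (rule pointwise_limitI[OF pointwise_hom_Vpow])
      (auto simp: Vpow_map_in hi lY ap_Vpow_map ap_limit[OF Y h l fX])
qed

text \<open>Since the diagram is T-weighted, \<open>c\<close> has pointwise values. Read at
  \<open>f x\<close>, they exhibit the image of \<open>c\<close> as a pointwise colimit over
  \<open>X\<close>.\<close>

lemma preserves_T_weighted_colimits_Vpow_map:
  "preserves_T_weighted_colimits \<T> (Vpow_tgraph \<T> Y) (Vpow_tgraph \<T> X) (Vpow_map \<T> X Y f)"
  unfolding preserves_T_weighted_colimits_def underlying_Vpow[OF X] underlying_Vpow[OF Y]
proof (intro allI impI)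
  fix I \<psi> h c
  assume "T_weighted_diagram \<T> (Vpow_tgraph \<T> Y) I \<psi> h \<and> is_colimit (Vpow_vcat \<T> Y) I \<psi> h c"
  then have d: "T_weighted_diagram \<T> (Vpow_tgraph \<T> Y) I \<psi> h"
    and c: "is_colimit (Vpow_vcat \<T> Y) I \<psi> h c" by auto
  have h: "h \<in> vcar I \<rightarrow> Vpow_set \<T> Y"
    using d unfolding T_weighted_diagram_def v_functor_def underlying_Vpow[OF Y] by simp
  have hi: "\<And>i. i \<in> vcar I \<Longrightarrow> h i \<in> Vpow_set \<T> Y" using h by auto
  have cY: "c \<in> Vpow_set \<T> Y" using c unfolding is_colimit_def by simp
  have fX: "\<And>x. x \<in> tcar X \<Longrightarrow> f x \<in> tcar Y" using T_morphism_in[OF f] by auto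
  show "is_colimit (Vpow_vcat \<T> X) I \<psi> (\<lambda>i. Vpow_map \<T> X Y f (h i)) (Vpow_map \<T> X Y f c)"
    by (rule pointwise_colimitI[OF pointwise_hom_Vpow])
      (auto simp: Vpow_map_in hi cY ap_Vpow_map
        ap_colimit[OF Y h T_functional_weighted_sup[OF Y d] c fX])
qed

text \<open>An element \<open>q\<close> over the image of \<open>p\<close> is traced back to an
  element \<open>r\<close> over \<open>p\<close> in two moves: a lift to T(X x \<open>V^Y\<close>)
  by the weak pullback, then \<open>f\<close> applied to the first coordinate.\<close>

lemma T_morphism_Vpow_map:
  "T_morphism \<T> (Vpow_tgraph \<T> Y) (Vpow_tgraph \<T> X) (Vpow_map \<T> X Y f)"
  unfolding T_morphism_def tcar_Vpow
proof (intro conjI ballI)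
  let ?U = "Vpow_set \<T> Y" and ?W = "Vpow_set \<T> X" and ?F = "Vpow_map \<T> X Y f"
  let ?P = "tcar X \<boxtimes> ?U" and ?D = "tcar X \<boxtimes> ?W" and ?E = "tcar Y \<boxtimes> ?U"
  let ?F' = "\<lambda>p. pair (pfst p) (?F (psnd p))" and ?f' = "\<lambda>p. pair (f (pfst p)) (psnd p)"
  let ?ev = "\<lambda>p. ap \<T> (psnd p) (pfst p)"
  show F: "?F \<in> ?U \<rightarrow> ?W" using Vpow_map_in by auto
  note sX = T_categoryD[OF X] and sY = T_categoryD[OF Y]
  note fX = T_morphism_in[OF f]
  note U = small_Vpow_set[OF sY] and W = small_Vpow_set[OF sX]
  have P: "small ?P" and D: "small ?D" and E: "small ?E" by (intro small_prodset sX sY U W)+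
  have pr: "pfst \<in> ?P \<rightarrow> tcar X" "psnd \<in> ?P \<rightarrow> ?U" "pfst \<in> ?D \<rightarrow> tcar X" "psnd \<in> ?D \<rightarrow> ?W"
    "pfst \<in> ?E \<rightarrow> tcar Y" "psnd \<in> ?E \<rightarrow> ?U" by (auto elim: prodsetE)
  have F': "?F' \<in> ?P \<rightarrow> ?D" and f': "?f' \<in> ?P \<rightarrow> ?E"
    using F fX by (auto elim!: prodsetE)
  \<comment> \<open>A pair over \<open>?W\<close> together with a preimage of its second component
    amounts to a point of \<open>X\<close> and an element of \<open>?U\<close>.\<close>
  have "is_pullback ?P ?D ?U ?W ?F' psnd psnd ?F"
  proof (rule is_pullbackI[OF F' pr(2) pr(4) F])
    fix a b assume "a \<in> ?D" "b \<in> ?U" "psnd a = ?F b"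
    then show "\<exists>w\<in>?P. ?F' w = a \<and> psnd w = b"
      by (elim prodsetE) (auto intro!: bexI[of _ "pair (pfst a) b"])
  qed (auto elim!: prodsetE simp: pair_eq_iff)
  note wp = T_pullback[OF P D U W this]
  fix p \<phi> assume p: "p \<in> Tob \<T> ?U" and \<phi>: "\<phi> \<in> ?U"
  let ?u = "tstr (Vpow_tgraph \<T> Y) p \<phi>"
  show "?u \<le> tstr (Vpow_tgraph \<T> X) (Tar \<T> ?U ?W ?F p) (?F \<phi>)"
    unfolding le_tstr_Vpow_iff
  proof (intro ballI impI)
    fix x q assume x: "x \<in> tcar X" and q: "q \<in> Tob \<T> ?D"
      and eq: "Tar \<T> ?D ?W psnd q = Tar \<T> ?U ?W ?F p"
    obtain w where w: "w \<in> Tob \<T> ?P" "Tar \<T> ?P ?D ?F' w = q" "Tar \<T> ?P ?U psnd w = p"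
      using weak_pullbackE[OF wp q p eq] .
    define r where "r = Tar \<T> ?P ?E ?f' w"
    have r: "r \<in> Tob \<T> ?E" unfolding r_def by (rule Tar_in[OF P E f' w(1)])
    have r1: "Tar \<T> ?E ?U psnd r = p"
      unfolding r_def Tar_comp[OF P E U f' pr(6) w(1)] using w(3) by simp
    have q1: "Tar \<T> ?D (tcar X) pfst q = Tar \<T> ?P (tcar X) pfst w"
      unfolding w(2)[symmetric] Tar_comp[OF P D sX F' pr(3) w(1)] by simp
    have r2: "Tar \<T> ?E (tcar Y) pfst r = Tar \<T> (tcar X) (tcar Y) f (Tar \<T> ?D (tcar X) pfst q)"
      unfolding r_def q1 Tar_comp[OF P E sY f' pr(5) w(1)] Tar_comp[OF P sX sY pr(1) fX w(1)]
      by simp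
    have "xi_ext \<T> ?D ?ev q = xi_ext \<T> ?P (\<lambda>p. ?ev (?F' p)) w"
      unfolding w(2)[symmetric] by (rule xi_ext_comp[OF P D F' w(1)])
    \<comment> \<open>At a point \<open>(x, \<phi>)\<close> of \<open>?P\<close> both evaluations
      give the value of \<open>\<phi>\<close> at \<open>f x\<close>.\<close>
    also have "\<dots> = xi_ext \<T> ?P (\<lambda>p. ?ev (?f' p)) w"
      by (rule xi_ext_cong[OF P _ w(1)]) (auto elim!: prodsetE simp: ap_Vpow_map)
    also have "\<dots> = xi_ext \<T> ?E ?ev r"
      unfolding r_def by (rule xi_ext_comp[OF P E f' w(1), symmetric])
    finally have ev: "xi_ext \<T> ?D ?ev q = xi_ext \<T> ?E ?ev r" .
    have "tstr X (Tar \<T> ?D (tcar X) pfst q) x \<le> tstr Y (Tar \<T> ?E (tcar Y) pfst r) (f x)"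
      using f x Tar_in[OF D sX pr(3) q] unfolding r2 T_morphism_def by blast
    then have "?u * (tstr X (Tar \<T> ?D (tcar X) pfst q) x * xi_ext \<T> ?D ?ev q)
        \<le> ?u * (tstr Y (Tar \<T> ?E (tcar Y) pfst r) (f x) * xi_ext \<T> ?E ?ev r)"
      unfolding ev by (intro quantale_mult_mono order.refl)
    also have "\<dots> \<le> ap \<T> \<phi> (f x)"
      using le_tstr_Vpow_iff[THEN iffD1, OF order.refl, of Y p \<phi>, THEN bspec, THEN bspec, OF _ r]
        fX x r1 by blast
    also have "\<dots> = ap \<T> (?F \<phi>) x" using ap_Vpow_map[OF \<phi> x] by simp
    finally show "?u * (tstr X (Tar \<T> ?D (tcar X) pfst q) x * xi_ext \<T> ?D ?ev q)
        \<le> ap \<T> (?F \<phi>) x" .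
  qed
qed

lemma T_frame_hom_Vpow_map:
  "T_frame_hom \<T> (Vpow_tgraph \<T> Y) (Vpow_tgraph \<T> X) (Vpow_map \<T> X Y f)"
  unfolding T_frame_hom_def
proof (intro conjI preserves_T_weighted_colimits_Vpow_map)
  show "T_compatible \<T> (Vpow_tgraph \<T> Y) (Vpow_tgraph \<T> X) (Vpow_map \<T> X Y f)"
    unfolding T_compatible_def
  proof (intro allI impI)
    fix I \<alpha> h assume "T_algebra \<T> I \<alpha> \<and> T_morphism \<T> (algebra_graph I \<alpha>) (Vpow_tgraph \<T> Y) h"
    then show "T_morphism \<T> (algebra_graph I \<alpha>) (Vpow_tgraph \<T> X) (\<lambda>i. Vpow_map \<T> X Y f (h i))"
      using T_morphism_comp[OF _ _ _ _ T_morphism_Vpow_map] small_Vpow_set T_categoryD[OF X]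
        T_categoryD[OF Y] unfolding T_algebra_def by (auto simp: algebra_graph_def)
  qed
qed (simp_all add: underlying_Vpow X Y v_functor_Vpow_map preserves_limits_Vpow_map)

end

lemma Vpow_map_id:
  assumes X: "T_category \<T> X"
  shows "Vpow_map \<T> X X (\<lambda>x\<in>tcar X. x) = (\<lambda>\<phi>\<in>Vpow_set \<T> X. \<phi>)"
proof (rule ext)
  fix \<phi>
  note sX = T_categoryD[OF X]
  have m: "T_morphism \<T> X X (\<lambda>x\<in>tcar X. x)"
    by (rule T_morphism_cong[OF sX sX T_morphism_id[OF sX]]) simp
  show "Vpow_map \<T> X X (\<lambda>x\<in>tcar X. x) \<phi> = (\<lambda>\<phi>\<in>Vpow_set \<T> X. \<phi>) \<phi>"
  proof (cases "\<phi> \<in> Vpow_set \<T> X")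
    case True
    then have "Vpow_map \<T> X X (\<lambda>x\<in>tcar X. x) \<phi> = \<phi>"
      by (intro Vpow_set_eqI[OF sX] Vpow_map_in[OF X X m]) (simp_all add: ap_Vpow_map[OF X X m])
    with True show ?thesis by simp
  qed (simp add: Vpow_map_def)
qed

lemma Vpow_map_comp:
  assumes X: "T_category \<T> X" and Y: "T_category \<T> Y" and Z: "T_category \<T> Z"
    and f: "T_morphism \<T> X Y f" and g: "T_morphism \<T> Y Z g"
  shows "Vpow_map \<T> X Z (compose (tcar X) g f)
    = compose (Vpow_set \<T> Z) (Vpow_map \<T> X Y f) (Vpow_map \<T> Y Z g)"
proof (rule ext)
  fix \<phi>
  note s = T_categoryD[OF X] T_categoryD[OF Y] T_categoryD[OF Z]
  have m: "T_morphism \<T> X Z (compose (tcar X) g f)"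
    by (rule T_morphism_cong[OF s(1,3) T_morphism_comp[OF s f g]]) (simp add: compose_eq)
  show "Vpow_map \<T> X Z (compose (tcar X) g f) \<phi>
    = compose (Vpow_set \<T> Z) (Vpow_map \<T> X Y f) (Vpow_map \<T> Y Z g) \<phi>"
  proof (cases "\<phi> \<in> Vpow_set \<T> Z")
    case True
    have "Vpow_map \<T> X Z (compose (tcar X) g f) \<phi> = Vpow_map \<T> X Y f (Vpow_map \<T> Y Z g \<phi>)"
      using True
      by (intro Vpow_set_eqI[OF s(1)] Vpow_map_in[OF X Y f] Vpow_map_in[OF Y Z g]
          Vpow_map_in[OF X Z m])
        (simp_all add: ap_Vpow_map[OF X Z m] ap_Vpow_map[OF X Y f] ap_Vpow_map[OF Y Z g]
          Vpow_map_in[OF Y Z g] compose_eq funcset_mem[OF T_morphism_in[OF f]])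
    with True show ?thesis by (simp add: compose_eq)
  qed (simp add: Vpow_map_def compose_def)
qed


section \<open>The categories\<close>

text \<open>All three categories are instances. \<open>cong\<close> bridges the gap between the
  plain maps in \<open>id\<close> and \<open>comp\<close> and the restricted ones that are the
  actual morphisms.\<close>

lemma concrete_category:
  assumes fn: "\<And>X Y f. P X Y f \<Longrightarrow> f \<in> car X \<rightarrow> car Y"
    and id: "\<And>X. X \<in> Ob \<Longrightarrow> P X X (\<lambda>x. x)"
    and comp: "\<And>X Y Z f g. X \<in> Ob \<Longrightarrow> Y \<in> Ob \<Longrightarrow> Z \<in> Ob \<Longrightarrow> P X Y f \<Longrightarrow> P Y Z g \<Longrightarrow>
      P X Z (\<lambda>x. g (f x))"
    and cong: "\<And>X Y f g. X \<in> Ob \<Longrightarrow> Y \<in> Ob \<Longrightarrow> P X Y f \<Longrightarrow> (\<And>x. x \<in> car X \<Longrightarrow> f x = g x) \<Longrightarrow>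
      P X Y g"
  shows "is_category \<lparr>Obj = Ob, Mor = \<lambda>X Y. {f \<in> extensional (car X). P X Y f},
    Idn = \<lambda>X. \<lambda>x\<in>car X. x, Cmp = \<lambda>X Y Z g f. compose (car X) g f\<rparr>"
  unfolding is_category_def cat.simps
proof (intro conjI ballI)
  fix X assume "X \<in> Ob"
  then show "(\<lambda>x\<in>car X. x) \<in> {f \<in> extensional (car X). P X X f}"
    by (auto intro: cong[OF _ _ id])
next
  fix X Y Z f g
  assume "X \<in> Ob" "Y \<in> Ob" "Z \<in> Ob"
    and "f \<in> {f \<in> extensional (car X). P X Y f}" "g \<in> {f \<in> extensional (car Y). P Y Z f}"
  then show "compose (car X) g f \<in> {f \<in> extensional (car X). P X Z f}"
    by (auto intro: cong[OF _ _ comp] simp: compose_eq)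
next
  fix X Y f
  assume "f \<in> {f \<in> extensional (car X). P X Y f}"
  then show "compose (car X) f (\<lambda>x\<in>car X. x) = f" "compose (car X) (\<lambda>x\<in>car Y. x) f = f"
    by (auto intro: compose_Id[OF fn] Id_compose[OF fn])
next
  fix W X Y Z f g h
  assume "f \<in> {f \<in> extensional (car W). P W X f}"
  then show "compose (car W) (compose (car X) h g) f = compose (car W) h (compose (car W) g f)"
    using fn by (auto intro!: compose_assoc[symmetric])
qed

lemma is_category_opposite: "is_category C \<Longrightarrow> is_category (opposite C)"
  unfolding is_category_def opposite_def by simp

lemma is_category_TCat: "is_category (TCat \<T>)"
  unfolding TCat_def
  by (rule concrete_category)
    (auto dest: T_categoryD T_morphism_in intro: T_morphism_id T_morphism_comp T_morphism_cong)

section \<open>Identities, composites and restrictions of limit-preserving V-functors\<close>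

lemma v_functor_in: "v_functor A B f \<Longrightarrow> f \<in> vcar A \<rightarrow> vcar B"
  unfolding v_functor_def by blast

lemma v_functor_id: "v_functor A A (\<lambda>x. x)"
  unfolding v_functor_def by simp

lemma v_functor_comp:
  assumes f: "v_functor A B f" and g: "v_functor B C g"
  shows "v_functor A C (\<lambda>x. g (f x))"
proof -
  have fA: "\<And>x. x \<in> vcar A \<Longrightarrow> f x \<in> vcar B" using v_functor_in[OF f] by auto
  show ?thesis
    unfolding v_functor_def
  proof (intro conjI ballI)
    fix x y assume "x \<in> vcar A" "y \<in> vcar A"
    then have "vhom A x y \<le> vhom B (f x) (f y)" "vhom B (f x) (f y) \<le> vhom C (g (f x)) (g (f y))"
      using f g fA unfolding v_functor_def by blast+
    then show "vhom A x y \<le> vhom C (g (f x)) (g (f y))" by (rule order_trans)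
  qed (use v_functor_in[OF g] fA in auto)
qed

lemma v_functor_cong:
  "v_functor A B f \<Longrightarrow> (\<And>x. x \<in> vcar A \<Longrightarrow> f x = g x) \<Longrightarrow> v_functor A B g"
  unfolding v_functor_def by (auto simp: Pi_def)

lemma preserves_limits_id: "preserves_limits A A (\<lambda>x. x)"
  unfolding preserves_limits_def by simp

text \<open>As \<open>f\<close> is a V-functor, its composite with the diagram is again a diagram,
  to which preservation by \<open>g\<close> applies.\<close>

lemma preserves_limits_comp:
  assumes "v_functor A B f" "preserves_limits A B f" "preserves_limits B C g"
  shows "preserves_limits A C (\<lambda>x. g (f x))"
  unfolding preserves_limits_def
proof (intro allI impI)
  fix I :: "('a, 'b) vgraph" and \<phi> h l
  assume a: "small_v_category I \<and> dist_to_one I \<phi> \<and> v_functor I A h \<and> is_limit A I \<phi> h l"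
  then have "is_limit B I \<phi> (\<lambda>i. f (h i)) (f l)"
    using assms(2) unfolding preserves_limits_def by blast
  with a v_functor_comp[OF _ assms(1)]
  show "is_limit C I \<phi> (\<lambda>i. g (f (h i))) (g (f l))"
    using assms(3)[unfolded preserves_limits_def, rule_format, of I \<phi> "\<lambda>i. f (h i)" "f l"] by blast
qed

lemma preserves_limits_cong:
  assumes "preserves_limits A B f" and eq: "\<And>x. x \<in> vcar A \<Longrightarrow> f x = g x"
  shows "preserves_limits A B g"
  unfolding preserves_limits_def
proof (intro allI impI)
  fix I :: "('a, 'b) vgraph" and \<phi> h l
  assume a: "small_v_category I \<and> dist_to_one I \<phi> \<and> v_functor I A h \<and> is_limit A I \<phi> h l"
  then have "is_limit B I \<phi> (\<lambda>i. f (h i)) (f l)"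
    using assms(1) unfolding preserves_limits_def by blast
  moreover have "f l = g l" using a eq unfolding is_limit_def by blast
  moreover have "f (h i) = g (h i)" if "i \<in> vcar I" for i
    using a that eq v_functor_in by blast
  ultimately show "is_limit B I \<phi> (\<lambda>i. g (h i)) (g l)"
    using is_limit_cong[of I "\<lambda>i. f (h i)" "\<lambda>i. g (h i)"] by simp
qed

lemma is_category_VCont: "is_category (VCont :: (('u, 'v) vgraph, 'u \<Rightarrow> 'u) cat)"
  unfolding VCont_def
  by (rule concrete_category)
    (auto dest: v_functor_in intro: v_functor_id v_functor_comp v_functor_cong preserves_limits_id
      preserves_limits_comp preserves_limits_cong)

section \<open>T-frame homomorphisms and their composition\<close>

lemma vcar_underlying [simp]: "vcar (underlying \<T> A) = tcar A"
  unfolding underlying_def by simp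

lemma T_frame_T_graph: "T_frame \<T> A \<Longrightarrow> T_graph \<T> A"
  unfolding T_frame_def by blast

lemma T_graph_small: "T_graph \<T> A \<Longrightarrow> small (tcar A)"
  unfolding T_graph_def by blast

text \<open>A tensor is a weighted colimit indexed by a one-element set; since \<open>T1 = 1\<close>, every such
  diagram is \<open>\<T>\<close>-weighted.\<close>

lemma T_frame_hom_tensor:
  assumes A: "T_graph \<T> A" and f: "T_frame_hom \<T> A B f" and x: "x \<in> tcar A"
    and t: "is_tensor (underlying \<T> A) v x t"
  shows "is_tensor (underlying \<T> B) v (f x) (f t)"
proof -
  let ?I = "\<lparr>vcar = {x}, vhom = \<lambda>_ _. 1\<rparr> :: ('u, 'v) vgraph"
  note sA = T_graph_small[OF A]
  have tA: "t \<in> tcar A" using t unfolding is_tensor_def by simp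
  have "T_algebra \<T> {x} (\<lambda>_. x)" unfolding T_algebra_def by (simp add: small_singleton)
  moreover have "T_morphism \<T> (algebra_graph {x} (\<lambda>_. x)) A (\<lambda>_. t)"
    using A tA Tar_const[OF small_singleton sA tA] unfolding T_morphism_def algebra_graph_def T_graph_def
    by simp
  moreover have "v_functor ?I (underlying \<T> A) (\<lambda>_. x)"
    using A x unfolding v_functor_def underlying_def T_graph_def by simp
  ultimately have "T_weighted_diagram \<T> A ?I (\<lambda>_. v) (\<lambda>_. x)"
    unfolding T_weighted_diagram_def small_v_category_def v_category_def dist_from_one_def
    using t by (intro conjI exI[of _ "\<lambda>_. x"] exI[of _ "\<lambda>_. t"]) (simp_all add: small_singleton)
  moreover have "is_colimit (underlying \<T> A) ?I (\<lambda>_. v) (\<lambda>_. x) t"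
    using t is_tensor_iff_colimit[of ?I x "underlying \<T> A" v x t] by simp
  ultimately have "is_colimit (underlying \<T> B) ?I (\<lambda>_. v) (\<lambda>_. f x) (f t)"
    using f unfolding T_frame_hom_def preserves_T_weighted_colimits_def by blast
  then show ?thesis using is_tensor_iff_colimit[of ?I x "underlying \<T> B" v "f x" "f t"] by simp
qed

text \<open>The images \<open>f (t i)\<close> serve as the chosen tensors: \<open>f\<close>
  preserves tensors, and compatibility keeps their assignment a morphism. Hence preservation of
  T-weighted colimits passes to composites.\<close>

lemma T_frame_hom_diagram:
  assumes A: "T_graph \<T> A" and f: "T_frame_hom \<T> A B f" and d: "T_weighted_diagram \<T> A I \<psi> h"
  shows "T_weighted_diagram \<T> B I \<psi> (\<lambda>i. f (h i))"
proof -
  obtain \<alpha> t where \<alpha>: "T_algebra \<T> (vcar I) \<alpha>"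
    and t: "\<And>i. i \<in> vcar I \<Longrightarrow> is_tensor (underlying \<T> A) (\<psi> i) (h i) (t i)"
    and tm: "T_morphism \<T> (algebra_graph (vcar I) \<alpha>) A t"
    and h: "v_functor I (underlying \<T> A) h"
    using d unfolding T_weighted_diagram_def by blast
  have "is_tensor (underlying \<T> B) (\<psi> i) (f (h i)) (f (t i))" if "i \<in> vcar I" for i
    using T_frame_hom_tensor[OF A f _ t[OF that]] v_functor_in[OF h] that by auto
  moreover have "T_morphism \<T> (algebra_graph (vcar I) \<alpha>) B (\<lambda>i. f (t i))"
    using f \<alpha> tm unfolding T_frame_hom_def T_compatible_def by blast
  moreover have "v_functor I (underlying \<T> B) (\<lambda>i. f (h i))"
    using f h v_functor_comp unfolding T_frame_hom_def by blast
  ultimately show ?thesis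
    using d \<alpha> unfolding T_weighted_diagram_def
    by (intro conjI exI[of _ \<alpha>] exI[of _ "\<lambda>i. f (t i)"]) auto
qed

lemma T_frame_hom_id: "T_frame_hom \<T> A A (\<lambda>x. x)"
  unfolding T_frame_hom_def T_compatible_def preserves_T_weighted_colimits_def
  by (simp add: v_functor_id preserves_limits_id)

lemma T_frame_hom_comp:
  assumes A: "T_graph \<T> A" and f: "T_frame_hom \<T> A B f" and g: "T_frame_hom \<T> B C g"
  shows "T_frame_hom \<T> A C (\<lambda>x. g (f x))"
  unfolding T_frame_hom_def
proof (intro conjI)
  show "T_compatible \<T> A C (\<lambda>x. g (f x))"
    using f g unfolding T_frame_hom_def T_compatible_def by blast
  show "preserves_T_weighted_colimits \<T> A C (\<lambda>x. g (f x))"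
    unfolding preserves_T_weighted_colimits_def
  proof (intro allI impI)
    fix I \<psi> h c
    assume a: "T_weighted_diagram \<T> A I \<psi> h \<and> is_colimit (underlying \<T> A) I \<psi> h c"
    then have "is_colimit (underlying \<T> B) I \<psi> (\<lambda>i. f (h i)) (f c)"
      using f unfolding T_frame_hom_def preserves_T_weighted_colimits_def by blast
    with T_frame_hom_diagram[OF A f] a
    show "is_colimit (underlying \<T> C) I \<psi> (\<lambda>i. g (f (h i))) (g (f c))"
      using g[unfolded T_frame_hom_def preserves_T_weighted_colimits_def, THEN conjunct2,
          THEN conjunct2, THEN conjunct2, rule_format, of I \<psi> "\<lambda>i. f (h i)" "f c"] by blast
  qed
qed (use f g v_functor_comp preserves_limits_comp in \<open>unfold T_frame_hom_def, blast+\<close>)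

lemma T_frame_hom_cong:
  assumes B: "small (tcar B)" and f: "T_frame_hom \<T> A B f"
    and eq: "\<And>x. x \<in> tcar A \<Longrightarrow> f x = g x"
  shows "T_frame_hom \<T> A B g"
  unfolding T_frame_hom_def
proof (intro conjI)
  have eq': "\<And>x. x \<in> vcar (underlying \<T> A) \<Longrightarrow> f x = g x" using eq by simp
  show "v_functor (underlying \<T> A) (underlying \<T> B) g"
      "preserves_limits (underlying \<T> A) (underlying \<T> B) g"
    using f by (auto simp: T_frame_hom_def intro: v_functor_cong[OF _ eq'] preserves_limits_cong[OF _ eq'])
  show "T_compatible \<T> A B g"
    unfolding T_compatible_def
  proof (intro allI impI)
    fix I \<alpha> h assume a: "T_algebra \<T> I \<alpha> \<and> T_morphism \<T> (algebra_graph I \<alpha>) A h"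
    then have "T_morphism \<T> (algebra_graph I \<alpha>) B (\<lambda>i. f (h i))"
      using f unfolding T_frame_hom_def T_compatible_def by blast
    moreover have "small (tcar (algebra_graph I \<alpha> :: ('u, 'v) tgraph))"
      using a unfolding T_algebra_def algebra_graph_def by simp
    ultimately show "T_morphism \<T> (algebra_graph I \<alpha>) B (\<lambda>i. g (h i))"
      using a B by (auto intro!: T_morphism_cong[of _ B "\<lambda>i. f (h i)"] eq dest: T_morphism_in)
  qed
  show "preserves_T_weighted_colimits \<T> A B g"
    unfolding preserves_T_weighted_colimits_def
  proof (intro allI impI)
    fix I \<psi> h c
    assume a: "T_weighted_diagram \<T> A I \<psi> h \<and> is_colimit (underlying \<T> A) I \<psi> h c"
    then have "is_colimit (underlying \<T> B) I \<psi> (\<lambda>i. f (h i)) (f c)"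
      using f unfolding T_frame_hom_def preserves_T_weighted_colimits_def by blast
    moreover have "f c = g c" using a eq' unfolding is_colimit_def by blast
    moreover have "f (h i) = g (h i)" if "i \<in> vcar I" for i
      using a that eq' v_functor_in unfolding T_weighted_diagram_def by blast
    ultimately show "is_colimit (underlying \<T> B) I \<psi> (\<lambda>i. g (h i)) (g c)"
      using is_colimit_cong[of I "\<lambda>i. f (h i)" "\<lambda>i. g (h i)"] by simp
  qed
qed

lemma T_frame_hom_in: "T_frame_hom \<T> A B f \<Longrightarrow> f \<in> tcar A \<rightarrow> tcar B"
  unfolding T_frame_hom_def by (auto dest!: v_functor_in)

lemma is_category_TFrm: "is_category (TFrm \<T>)"
  unfolding TFrm_def
  by (rule concrete_category)
    (auto dest: T_frame_hom_in T_frame_T_graph T_graph_small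
      intro: T_frame_hom_id T_frame_hom_comp T_frame_hom_cong)

section \<open>Functoriality and the factorization\<close>

lemma is_functor_Vpow: "is_functor (opposite (TCat \<T>)) VCont (Vpow \<T>)"
  unfolding is_functor_def
proof (intro conjI is_category_opposite is_category_TCat is_category_VCont)
qed (auto simp: opposite_def TCat_def VCont_def Vpow_def Vpow_small_v_category Vpow_v_complete
    v_functor_Vpow_map preserves_limits_Vpow_map Vpow_map_id Vpow_map_comp,
    auto simp: Vpow_map_def)

lemma is_functor_Omega: "is_functor (opposite (TCat \<T>)) (TFrm \<T>) (Omega \<T>)"
  unfolding is_functor_def
proof (intro conjI is_category_opposite is_category_TCat is_category_TFrm)
qed (auto simp: opposite_def TCat_def TFrm_def Omega_def T_frame_Vpow
    T_frame_hom_Vpow_map Vpow_map_id Vpow_map_comp,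
    auto simp: Vpow_map_def)

lemma is_functor_forgetful: "is_functor (TFrm \<T>) VCont (forgetful \<T>)"
  unfolding is_functor_def
proof (intro conjI is_category_TFrm is_category_VCont)
qed (auto simp: TFrm_def VCont_def forgetful_def T_frame_def T_graph_def small_v_category_def
    T_frame_hom_def)

text \<open>On objects this is \<open>underlying_Vpow\<close>; on morphisms both sides are the same
  map \<open>Vpow_map\<close>.\<close>

lemma functor_eq_forgetful_Omega:
  "functor_eq (opposite (TCat \<T>)) (functor_comp (forgetful \<T>) (Omega \<T>)) (Vpow \<T>)"
  unfolding functor_eq_def functor_comp_def opposite_def TCat_def forgetful_def Omega_def Vpow_def
  by (simp add: underlying_Vpow)

end

theorem corollary2p10:
  fixes \<T> :: "('u::set_universe, 'v::comm_quantale) top_theory"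
  assumes "strict_top_theory \<T>"
    and "T_one_eq_one \<T>"
  shows "is_functor (opposite (TCat \<T>)) VCont (Vpow \<T>) \<and>
         is_functor (TFrm \<T>) VCont (forgetful \<T>) \<and>
         is_functor (opposite (TCat \<T>)) (TFrm \<T>) (Omega \<T>) \<and>
         functor_eq (opposite (TCat \<T>)) (functor_comp (forgetful \<T>) (Omega \<T>)) (Vpow \<T>)"
proof -
  interpret T_one_theory \<T> by (rule T_one_theory.intro) (fact assms)+
  show ?thesis
    by (intro conjI is_functor_Vpow is_functor_forgetful is_functor_Omega functor_eq_forgetful_Omega)
qed

end
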